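(* Let $n>1$ be an integer, let $p_n(z)=z(z^n-1)$, and let $C_n$ be Chebyshev's method applied to $p_n$. Then the symmetry groups of $p_n$ and $C_n$ are identical: $\Sigma p_n=\Sigma C_n$.
   Context: Chebyshev's method applied to a polynomial $p$ is the rational map $C_p(z)=z-\left(1+\frac12 L_p(z)\right)\frac{p(z)}{p'(z)}$, where $L_p(z)=\frac{p(z)p''(z)}{(p'(z))^2}$, viewed as a self-map of the Riemann sphere $\widehat{\mathbb C}$. For $p_n(z)=z(z^n-1)$ one has $C_n(z)=\frac{z^{n+1}\left(n(n+1)(2n+1)z^{2n}-2n(n+1)z^n-n(n-1)\right)}{2\left((n+1)z^n-1\right)^3}$. The Fatou set of a rational map $R$ is the maximal open subset of $\widehat{\mathbb C}$ on which the family of iterates $\{R^m: m\in\mathbb N\}$ is equicontinuous; the Julia set $\mathcal J(R)$ is its complement in $\widehat{\mathbb C}$. The symmetry group $\Sigma R$ of a rational map $R$ (in particular of a polynomial, viewed as a rational map) is the set of all holomorphic Euclidean isometries $\sigma(z)=az+b$, with $a,b\in\mathbb C$, $|a|=1$, such that $\sigma(\mathcal J(R))=\mathcal J(R)$. *)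

theory Defs
  imports
    "HOL-Analysis.Analysis"
    "HOL-Computational_Algebra.Computational_Algebra"
    "HOL-Computational_Algebra.Field_as_Ring"
begin

section \<open>The Riemann sphere with the chordal metric\<close>

datatype riemann_sphere = Cplx complex | Infty

text \<open>Inverse stereographic projection onto the unit sphere of
  \<^typ>\<open>complex \<times> real\<close>, with \<^const>\<open>Infty\<close> as the north pole.\<close>

fun stereo :: "riemann_sphere \<Rightarrow> complex \<times> real" where
  "stereo (Cplx z) =
     ((2 / (1 + (cmod z)\<^sup>2)) *\<^sub>R z, ((cmod z)\<^sup>2 - 1) / (1 + (cmod z)\<^sup>2))"
| "stereo Infty = (0, 1)"

lemma one_plus_sq_pos: "1 + (x::real)\<^sup>2 > 0"
  by (simp add: add_pos_nonneg)

lemma stereo_snd_less: "snd (stereo (Cplx z)) < 1"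
  using one_plus_sq_pos[of "cmod z"] by (simp add: divide_less_eq)

lemma stereo_inject: "stereo x = stereo y \<longleftrightarrow> x = y"
proof
  assume eq: "stereo x = stereo y"
  show "x = y"
  proof (cases x; cases y)
    fix z w assume x: "x = Cplx z" and y: "y = Cplx w"
    have pz: "1 + (cmod z)\<^sup>2 > 0" and pw: "1 + (cmod w)\<^sup>2 > 0"
      using one_plus_sq_pos by blast+
    have "((cmod z)\<^sup>2 - 1) / (1 + (cmod z)\<^sup>2) = ((cmod w)\<^sup>2 - 1) / (1 + (cmod w)\<^sup>2)"
      using eq x y by simp
    then have "((cmod z)\<^sup>2 - 1) * (1 + (cmod w)\<^sup>2) = ((cmod w)\<^sup>2 - 1) * (1 + (cmod z)\<^sup>2)"
      using pz pw by (simp add: frac_eq_eq)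
    then have "(cmod z)\<^sup>2 = (cmod w)\<^sup>2" by (simp add: algebra_simps)
    moreover have "(2 / (1 + (cmod z)\<^sup>2)) *\<^sub>R z = (2 / (1 + (cmod w)\<^sup>2)) *\<^sub>R w"
      using eq x y by simp
    ultimately have "z = w" using pw by (metis divide_eq_0_iff less_irrefl scaleR_cancel_left zero_neq_numeral)
    then show ?thesis using x y by simp
  qed (use eq stereo_snd_less in \<open>metis less_irrefl snd_conv stereo.simps(2)\<close>)+
qed simp

instantiation riemann_sphere :: metric_space
begin

definition dist_riemann_sphere :: "riemann_sphere \<Rightarrow> riemann_sphere \<Rightarrow> real" where
  "dist_riemann_sphere x y = dist (stereo x) (stereo y)"

definition uniformity_riemann_sphere :: "(riemann_sphere \<times> riemann_sphere) filter" where
  "uniformity_riemann_sphere = (INF e\<in>{0 <..}. principal {(x, y). dist x y < e})"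

definition open_riemann_sphere :: "riemann_sphere set \<Rightarrow> bool" where
  "open_riemann_sphere U \<longleftrightarrow>
     (\<forall>x\<in>U. eventually (\<lambda>(x', y). x' = x \<longrightarrow> y \<in> U) uniformity)"

instance
proof
  fix x y z :: riemann_sphere
  show "dist x y = 0 \<longleftrightarrow> x = y"
    by (simp add: dist_riemann_sphere_def stereo_inject)
  show "dist x y \<le> dist x z + dist y z"
    by (simp add: dist_riemann_sphere_def dist_triangle2)
qed (simp_all add: uniformity_riemann_sphere_def open_riemann_sphere_def)

end

lemma dist_Cplx_Infty: "dist (Cplx z) Infty = 2 / sqrt (1 + (cmod z)\<^sup>2)"
proof -
  let ?p = "1 + (cmod z)\<^sup>2"
  have p: "?p > 0" by (rule one_plus_sq_pos)
  have "((cmod z)\<^sup>2 - 1) / ?p - 1 = - (2 / ?p)" using p by (simp add: field_simps)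
  then have "dist (Cplx z) Infty = sqrt ((2 / ?p * cmod z)\<^sup>2 + (2 / ?p)\<^sup>2)"
    using p by (simp add: dist_riemann_sphere_def dist_prod_def dist_real_def)
  also have "(2 / ?p * cmod z)\<^sup>2 + (2 / ?p)\<^sup>2 = (2 / ?p)\<^sup>2 * ?p"
    unfolding power_mult_distrib by (simp only: distrib_left mult_1_right add.commute)
  also have "\<dots> = 2\<^sup>2 / ?p"
  proof -
    have "(2 / a)\<^sup>2 * a = 2\<^sup>2 / a" if "a > 0" for a :: real
      using that by (simp add: power2_eq_square)
    then show ?thesis using p .
  qed
  finally show ?thesis by (simp add: real_sqrt_divide)
qed

lemma dist_Cplx_Cplx:
  "dist (Cplx z) (Cplx w) = 2 * cmod (z - w) / (sqrt (1 + (cmod z)\<^sup>2) * sqrt (1 + (cmod w)\<^sup>2))"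
proof -
  let ?p = "1 + (cmod z)\<^sup>2" and ?q = "1 + (cmod w)\<^sup>2"
  have p: "?p > 0" "?q > 0" by (rule one_plus_sq_pos)+
  have n: "(cmod v)\<^sup>2 = (Re v)\<^sup>2 + (Im v)\<^sup>2" for v by (rule cmod_power2)
  have 1: "(2 / ?p) *\<^sub>R z - (2 / ?q) *\<^sub>R w = (2 / (?p * ?q)) *\<^sub>R (?q *\<^sub>R z - ?p *\<^sub>R w)"
  proof -
    have "2 / (a * b) * b = 2 / a" "2 / (a * b) * a = 2 / b" if "a > 0" "b > 0" for a b :: real
      using that by simp_all
    from this[OF p] show ?thesis by (simp only: scaleR_diff_right scaleR_scaleR)
  qed
  have 2: "((cmod z)\<^sup>2 - 1) / ?p - ((cmod w)\<^sup>2 - 1) / ?q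
      = (2 / (?p * ?q)) * ((cmod z)\<^sup>2 - (cmod w)\<^sup>2)"
  proof -
    have "((cmod z)\<^sup>2 - 1) / ?p - ((cmod w)\<^sup>2 - 1) / ?q
      = (((cmod z)\<^sup>2 - 1) * ?q - ((cmod w)\<^sup>2 - 1) * ?p) / (?p * ?q)"
      using p by (simp add: diff_frac_eq)
    also have "((cmod z)\<^sup>2 - 1) * ?q - ((cmod w)\<^sup>2 - 1) * ?p = 2 * ((cmod z)\<^sup>2 - (cmod w)\<^sup>2)"
      by (simp add: algebra_simps)
    finally show ?thesis by simp
  qed
  have 3: "(cmod (?q *\<^sub>R z - ?p *\<^sub>R w))\<^sup>2 + ((cmod z)\<^sup>2 - (cmod w)\<^sup>2)\<^sup>2
      = (?p * ?q) * (cmod (z - w))\<^sup>2"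
    unfolding n by (simp add: power2_eq_square algebra_simps)
  have "dist (Cplx z) (Cplx w)
      = sqrt ((2 / (?p * ?q) * cmod (?q *\<^sub>R z - ?p *\<^sub>R w))\<^sup>2
          + (2 / (?p * ?q) * ((cmod z)\<^sup>2 - (cmod w)\<^sup>2))\<^sup>2)"
    unfolding dist_riemann_sphere_def dist_prod_def stereo.simps fst_conv snd_conv
      dist_norm 1 2 norm_scaleR real_norm_def power2_abs
    using p by simp
  also have "(2 / (?p * ?q) * cmod (?q *\<^sub>R z - ?p *\<^sub>R w))\<^sup>2
          + (2 / (?p * ?q) * ((cmod z)\<^sup>2 - (cmod w)\<^sup>2))\<^sup>2
      = (2 / (?p * ?q))\<^sup>2 * ((?p * ?q) * (cmod (z - w))\<^sup>2)"
    unfolding power_mult_distrib 3[symmetric] by (simp only: distrib_left)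
  also have "\<dots> = (2 * cmod (z - w))\<^sup>2 / (?p * ?q)"
    using p by (simp add: power2_eq_square)
  finally show ?thesis by (simp add: real_sqrt_divide real_sqrt_mult)
qed

section \<open>Rational maps as self-maps of the sphere\<close>

text \<open>\<^const>\<open>quot_of_fract\<close> yields the numerator and denominator in lowest terms,
  with monic denominator.  The value at \<^const>\<open>Infty\<close> is the limit of
  \<open>a(z) / b(z)\<close> as \<open>z \<rightarrow> \<infinity>\<close>; note that
  \<open>coeff a (degree b) = 0\<close> when \<open>degree a < degree b\<close>.\<close>

fun sphere_map :: "complex poly fract \<Rightarrow> riemann_sphere \<Rightarrow> riemann_sphere" where
  "sphere_map R (Cplx z) =
     (let (a, b) = quot_of_fract R
      in if poly b z = 0 then Infty else Cplx (poly a z / poly b z))"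
| "sphere_map R Infty =
     (let (a, b) = quot_of_fract R
      in if degree a > degree b then Infty
         else Cplx (coeff a (degree b) / lead_coeff b))"

text \<open>Any representation in lowest terms may be used to evaluate.\<close>

lemma quot_of_fract_Fract_coprime:
  fixes a b :: "complex poly"
  assumes "coprime a b" "b \<noteq> 0"
  shows "\<exists>c. c \<noteq> 0 \<and> a = smult c (fst (quot_of_fract (Fract a b)))
           \<and> b = smult c (snd (quot_of_fract (Fract a b)))"
proof -
  have q: "quot_of_fract (Fract a b) = normalize_quot (a, b)"
    using quot_of_fract_quot_to_fract[of "(a, b)"] by (simp add: quot_to_fract_def)
  obtain d where d: "a = fst (normalize_quot (a,b)) * d" "b = snd (normalize_quot (a,b)) * d"
      "d dvd a" "d dvd b" "d \<noteq> 0"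
    using normalize_quotE[OF assms(2)] by blast
  have "is_unit d" using assms(1) d(3,4) by (rule coprime_common_divisor)
  then obtain c where c: "d = [:c:]" "c \<noteq> 0"
    using d(5) by (auto simp: is_unit_poly_iff)
  show ?thesis
    using d(1,2) c by (intro exI[of _ c]) (simp add: q)
qed

lemma sphere_map_Fract:
  fixes a b :: "complex poly"
  assumes "coprime a b" "b \<noteq> 0"
  shows "sphere_map (Fract a b) (Cplx z) =
           (if poly b z = 0 then Infty else Cplx (poly a z / poly b z))"
    and "sphere_map (Fract a b) Infty =
           (if degree a > degree b then Infty else Cplx (coeff a (degree b) / lead_coeff b))"
proof -
  obtain c where c: "c \<noteq> 0" "a = smult c (fst (quot_of_fract (Fract a b)))"
      "b = smult c (snd (quot_of_fract (Fract a b)))"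
    using quot_of_fract_Fract_coprime[OF assms] by blast
  obtain u v where uv: "quot_of_fract (Fract a b) = (u, v)" by (cases "quot_of_fract (Fract a b)")
  have ab: "a = smult c u" "b = smult c v" using c uv by simp_all
  show "sphere_map (Fract a b) (Cplx z) =
           (if poly b z = 0 then Infty else Cplx (poly a z / poly b z))"
    unfolding sphere_map.simps uv using c(1) by (simp add: ab)
  show "sphere_map (Fract a b) Infty =
           (if degree a > degree b then Infty else Cplx (coeff a (degree b) / lead_coeff b))"
    unfolding sphere_map.simps uv using c(1) by (simp add: ab)
qed

section \<open>Fatou and Julia sets\<close>

definition equicontinuous_on ::
    "'a::metric_space set \<Rightarrow> ('a \<Rightarrow> 'b::metric_space) set \<Rightarrow> bool" where
  "equicontinuous_on U F \<longleftrightarrow>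
     (\<forall>x\<in>U. \<forall>e>0. \<exists>d>0. \<forall>f\<in>F. \<forall>y\<in>U. dist y x < d \<longrightarrow> dist (f y) (f x) < e)"

definition iterates :: "('a \<Rightarrow> 'a) \<Rightarrow> ('a \<Rightarrow> 'a) set" where
  "iterates f = range (\<lambda>m::nat. f ^^ m)"

definition fatou_set :: "complex poly fract \<Rightarrow> riemann_sphere set" where
  "fatou_set R = \<Union>{U. open U \<and> equicontinuous_on U (iterates (sphere_map R))}"

definition julia_set :: "complex poly fract \<Rightarrow> riemann_sphere set" where
  "julia_set R = - fatou_set R"

text \<open>The union is itself an open set of equicontinuity, hence the largest one.\<close>

lemma open_fatou_set: "open (fatou_set R)"
  unfolding fatou_set_def by (rule open_Union) simp

lemma equicontinuous_on_fatou_set: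
  "equicontinuous_on (fatou_set R) (iterates (sphere_map R))"
  unfolding equicontinuous_on_def
proof (intro ballI allI impI)
  fix x and e :: real assume "x \<in> fatou_set R" "e > 0"
  then obtain U where U: "open U" "x \<in> U" "equicontinuous_on U (iterates (sphere_map R))"
    unfolding fatou_set_def by blast
  obtain d1 where d1: "d1 > 0" "\<And>y. dist y x < d1 \<Longrightarrow> y \<in> U"
    using U(1,2) by (auto simp: open_dist)
  obtain d2 where d2: "d2 > 0"
      "\<And>f y. f \<in> iterates (sphere_map R) \<Longrightarrow> y \<in> U \<Longrightarrow> dist y x < d2 \<Longrightarrow> dist (f y) (f x) < e"
    using U(2,3) \<open>e > 0\<close> unfolding equicontinuous_on_def by meson
  show "\<exists>d>0. \<forall>f\<in>iterates (sphere_map R). \<forall>y\<in>fatou_set R. dist y x < d \<longrightarrow> dist (f y) (f x) < e"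
    using d1 d2 by (intro exI[of _ "min d1 d2"]) auto
qed

section \<open>Symmetry groups\<close>

fun extend_to_sphere :: "(complex \<Rightarrow> complex) \<Rightarrow> riemann_sphere \<Rightarrow> riemann_sphere" where
  "extend_to_sphere s (Cplx z) = Cplx (s z)"
| "extend_to_sphere s Infty = Infty"

definition symmetry_group :: "complex poly fract \<Rightarrow> (complex \<Rightarrow> complex) set" where
  "symmetry_group R =
     {s. (\<exists>a b. cmod a = 1 \<and> s = (\<lambda>z. a * z + b))
         \<and> extend_to_sphere s ` julia_set R = julia_set R}"

section \<open>Chebyshev's method\<close>

definition chebyshev_L :: "complex poly \<Rightarrow> complex poly fract" where
  "chebyshev_L p = to_fract p * to_fract (pderiv (pderiv p)) / (to_fract (pderiv p))\<^sup>2"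

definition chebyshev :: "complex poly \<Rightarrow> complex poly fract" where
  "chebyshev p =
     to_fract [:0, 1:] - (1 + 1 / 2 * chebyshev_L p) * (to_fract p / to_fract (pderiv p))"

definition p_poly :: "nat \<Rightarrow> complex poly" where
  "p_poly n = [:0, 1:] * ([:0, 1:] ^ n - 1)"

lemma pderiv_p_poly: "pderiv (p_poly n) = of_nat (n + 1) * [:0, 1:] ^ n - 1"
proof -
  have "pderiv (p_poly n) = [:0, 1:] * (of_nat n * [:0, 1:] ^ (n - 1)) + ([:0, 1:] ^ n - 1)"
    unfolding p_poly_def
    by (simp only: pderiv_mult pderiv_diff pderiv_power pderiv_1 of_nat_poly) (simp add: pderiv_pCons)
  also have "[:0, 1:] * (of_nat n * [:0, 1:] ^ (n - 1)) = of_nat n * ([:0, 1::complex:] ^ n)"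
    by (cases n) (simp_all add: algebra_simps)
  finally show ?thesis by (simp add: algebra_simps)
qed

lemma pderiv2_p_poly:
  "pderiv (pderiv (p_poly n)) = of_nat (n + 1) * of_nat n * [:0, 1:] ^ (n - 1)"
  unfolding pderiv_p_poly
  by (simp only: pderiv_mult pderiv_diff pderiv_power pderiv_1 of_nat_poly) (simp add: pderiv_pCons)

lemma to_fract_of_nat: "to_fract (of_nat k) = of_nat k"
  by (induction k) simp_all

lemma to_fract_power: "to_fract (a ^ k) = to_fract a ^ k"
  by (induction k) simp_all

lemma chebyshev_p_poly:
  assumes "n > 0"
  defines "X \<equiv> [:0, 1 :: complex:]"
  shows "chebyshev (p_poly n) =
    Fract (X ^ (n + 1) * (of_nat (n * (n + 1) * (2 * n + 1)) * X ^ (2 * n)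
                          - of_nat (2 * n * (n + 1)) * X ^ n - of_nat (n * (n - 1))))
          (2 * (of_nat (n + 1) * X ^ n - 1) ^ 3)"
proof -
  define x :: "complex poly fract" where "x = to_fract X"
  define N :: "complex poly fract" where "N = of_nat n"
  define D where "D = (N + 1) * x ^ n - 1"
  have D: "to_fract (pderiv (p_poly n)) = D"
    by (simp add: pderiv_p_poly D_def N_def x_def X_def to_fract_of_nat to_fract_power)
  have "poly (pderiv (p_poly n)) 0 = -1"
    using assms(1) by (simp add: pderiv_p_poly)
  then have "pderiv (p_poly n) \<noteq> 0" by auto
  then have D0: "D \<noteq> 0" using D by (metis to_fract_eq_0_iff)
  have P: "to_fract (p_poly n) = x * (x ^ n - 1)"
    by (simp only: p_poly_def x_def X_def to_fract_mult to_fract_diff to_fract_power to_fract_1)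
  have S: "to_fract (pderiv (pderiv (p_poly n))) = (N + 1) * N * x ^ (n - 1)"
    by (simp add: pderiv2_p_poly N_def x_def X_def to_fract_of_nat to_fract_power)
  have xx: "x * x ^ (n - 1) = x ^ n" using assms(1) by (cases n) simp_all
  have two: "(2 :: complex poly fract) \<noteq> 0"
    using to_fract_of_nat[of 2, where 'a = "complex poly"]
    by (metis of_nat_numeral to_fract_eq_0_iff zero_neq_numeral)
  have "chebyshev (p_poly n) =
      x - (1 + 1 / 2 * (x * (x ^ n - 1) * ((N + 1) * N * x ^ (n - 1)) / D\<^sup>2)) * (x * (x ^ n - 1) / D)"
    unfolding chebyshev_def chebyshev_L_def D P S by (simp add: x_def X_def)
  also have "x * (x ^ n - 1) * ((N + 1) * N * x ^ (n - 1)) = (N + 1) * N * (x ^ n - 1) * x ^ n"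
    unfolding xx[symmetric] by (simp only: ac_simps)
  also have "x - (1 + 1 / 2 * ((N + 1) * N * (x ^ n - 1) * x ^ n / D\<^sup>2)) * (x * (x ^ n - 1) / D) =
      (2 * x * D ^ 3 - 2 * D\<^sup>2 * x * (x ^ n - 1) - (N + 1) * N * (x ^ n - 1)\<^sup>2 * x ^ n * x) / (2 * D ^ 3)"
    using D0 two by (simp add: field_simps power2_eq_square power3_eq_cube)
  also have "2 * x * D ^ 3 - 2 * D\<^sup>2 * x * (x ^ n - 1) - (N + 1) * N * (x ^ n - 1)\<^sup>2 * x ^ n * x =
      x * x ^ n * (N * (N + 1) * (2 * N + 1) * (x ^ n)\<^sup>2 - 2 * N * (N + 1) * x ^ n - N * (N - 1))"
    unfolding D_def by (simp add: algebra_simps power2_eq_square power3_eq_cube)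
  also have "\<dots> / (2 * D ^ 3) =
      Fract (X ^ (n + 1) * (of_nat (n * (n + 1) * (2 * n + 1)) * X ^ (2 * n)
                          - of_nat (2 * n * (n + 1)) * X ^ n - of_nat (n * (n - 1))))
          (2 * (of_nat (n + 1) * X ^ n - 1) ^ 3)"
  proof -
    have t2: "to_fract (2 :: complex poly) = 2"
      using to_fract_of_nat[of 2, where 'a = "complex poly"] by simp
    have 1: "to_fract (of_nat (n * (n - 1)) :: complex poly) = N * (N - 1)"
      using assms(1) by (simp add: to_fract_of_nat N_def of_nat_diff)
    have 2: "to_fract (of_nat (n * (n + 1) * (2 * n + 1)) :: complex poly) = N * (N + 1) * (2 * N + 1)"
      "to_fract (of_nat (2 * n * (n + 1)) :: complex poly) = 2 * N * (N + 1)"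
      "to_fract (of_nat (n + 1) :: complex poly) = N + 1"
      unfolding to_fract_of_nat N_def by (simp_all add: algebra_simps)
    show ?thesis
      unfolding Fract_conv_to_fract to_fract_mult to_fract_diff to_fract_power 1 2 t2 to_fract_1
        x_def[symmetric] D_def[symmetric]
      by (simp add: power_mult[symmetric] mult.commute)
  qed
  finally show ?thesis .
qed

end

theory Submission
  imports Defs "HOL-Complex_Analysis.Complex_Analysis"
begin

text \<open>
  Both groups are the group of rotations by \<open>n\<close>-th roots of unity.  These rotations are
  symmetries because they commute with \<open>p\<^sub>n\<close> and with \<open>C\<^sub>n\<close> (\<open>rotation_mem_symmetry_group\<close>).  For the converse the two maps
  need different arguments.

  For the polynomial the point is that its Julia set has capacity \<open>1\<close>: a polynomial that is
  bounded by \<open>M\<close> on the Julia set has a leading coefficient of modulus at most \<open>M\<close>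
  (\<open>lead_coeff_bound_julia\<close>), by the maximum principle outside the lemniscates of the monic
  iterates \<open>p\<^sup>k\<close>.  If \<open>\<sigma> z = a z + b\<close> is a symmetry, then
  \<open>p\<^sup>k \<circ> \<sigma> - a ^ (d ^ k) p\<^sup>k\<close> with \<open>d = degree p\<close> is bounded on the Julia set uniformly in \<open>k\<close>.  But
  if it is nonzero for some \<open>k\<close>, its leading coefficient is multiplied by \<open>d\<close> in modulus whenever \<open>k\<close>
  increases.  Hence it vanishes, which for \<open>k = 0, 1\<close> says that \<open>b = 0\<close> and
  \<open>p (a z) = a ^ d p z\<close> (\<open>symmetry_equivariant\<close>).

  Chebyshev's method has a repelling fixed point at infinity, where it is the
  linear contraction \<open>z \<mapsto> \<kappa> z\<close> of the plane up to a bounded error.  Its Julia set is unbounded, because the rays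
  from the different roots of unity to infinity lie in different basins
  (\<open>julia_unbounded\<close>).  It is invariant under no translation: pushing the lattice of translates of a Julia point
  towards the origin by the contraction would produce Julia points close to translates of the fixed point \<open>0\<close>, which
  lies in the Fatou set (\<open>translation_invariant_meets_ray\<close>, \<open>no_translation\<close>).  Since the commutator of a
  symmetry with the rotation by a primitive root of unity is a translation, every symmetry is a
  rotation about \<open>0\<close>.  For these, pass to \<open>u = z ^ n\<close>, where the method becomes
  \<open>Q u = K u + c + O (1 / u)\<close> with real \<open>c \<noteq> 0\<close>.  If a rotation \<open>u \<mapsto> a u\<close> with \<open>a \<noteq> 1\<close> preserves the Julia set, then so does
  the correspondence \<open>Q (a v) = a Q u\<close>, and it moves every distant point by nearly
  the same vector \<open>(1 - 1 / a) c / K\<close> (\<open>rotation_drift\<close>).  Following these drifts, the Julia set would reach the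
  direction of the positive real axis (\<open>rotation_trivial\<close>), but a whole sector around that axis lies in the basin of
  \<open>1\<close> (\<open>sector_avoids\<close>).
\<close>

section \<open>Topology of the sphere\<close>

lemma dist_Cplx_le: "dist (Cplx z) (Cplx w) \<le> 2 * cmod (z - w)"
proof -
  have "1 * 1 \<le> sqrt (1 + (cmod z)\<^sup>2) * sqrt (1 + (cmod w)\<^sup>2)"
    by (intro mult_mono) auto
  then show ?thesis
    unfolding dist_Cplx_Cplx by (intro divide_le_eq[THEN iffD2]) (auto simp: mult_le_cancel_left1)
qed

lemma continuous_on_Cplx: "continuous_on S Cplx"
proof (rule continuous_onI)
  fix z :: complex and e :: real assume "e > 0"
  then show "\<exists>d>0. \<forall>w\<in>S. dist w z < d \<longrightarrow> dist (Cplx w) (Cplx z) \<le> e"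
    by (intro exI[of _ "e/2"]) (auto intro!: order_trans[OF dist_Cplx_le] simp: dist_norm)
qed

text \<open>Stereographic projection inverts \<^const>\<open>Cplx\<close> continuously, so the plane carries its usual
  topology inside the sphere.\<close>

definition affine_part :: "riemann_sphere \<Rightarrow> complex" where
  "affine_part x = fst (stereo x) /\<^sub>R (1 - snd (stereo x))"

lemma affine_part_Cplx [simp]: "affine_part (Cplx z) = z"
proof -
  have p: "1 + (cmod z)\<^sup>2 > 0" by (rule one_plus_sq_pos)
  then have "1 - ((cmod z)\<^sup>2 - 1) / (1 + (cmod z)\<^sup>2) = 2 / (1 + (cmod z)\<^sup>2)"
    by (simp add: field_simps)
  then show ?thesis using p by (simp add: affine_part_def)
qed

lemma continuous_on_affine_part: "continuous_on (- {Infty}) affine_part"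
proof -
  have "continuous_on S stereo" for S
    unfolding continuous_on_iff dist_riemann_sphere_def[symmetric] by blast
  moreover have "1 - snd (stereo x) \<noteq> 0" if "x \<noteq> Infty" for x
    using that stereo_snd_less by (cases x) fastforce+
  ultimately show ?thesis
    unfolding affine_part_def by (intro continuous_intros) auto
qed

lemma open_Cplx_image: "open (Cplx ` U)" if "open U"
proof -
  have "Cplx ` U = - {Infty} \<inter> affine_part -` U"
  proof (intro equalityI subsetI)
    fix x assume "x \<in> - {Infty} \<inter> affine_part -` U"
    then show "x \<in> Cplx ` U" by (cases x) auto
  qed auto
  moreover have "open (- {Infty} \<inter> affine_part -` U)"
    by (rule continuous_open_preimage[OF continuous_on_affine_part _ that]) auto
  ultimately show ?thesis by simp
qed

lemma open_Cplx_vimage: "open (Cplx -` U)" if "open U"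
  using that continuous_on_Cplx by (rule open_vimage)

section \<open>Membership in the Fatou set\<close>

lemma fatou_setD:
  assumes "x \<in> fatou_set R" "e > 0"
  shows "\<exists>d>0. \<forall>y. dist y x < d \<longrightarrow> y \<in> fatou_set R \<and>
           (\<forall>m. dist ((sphere_map R ^^ m) y) ((sphere_map R ^^ m) x) < e)"
proof -
  obtain d1 where d1: "d1 > 0" "\<And>y. dist y x < d1 \<Longrightarrow> y \<in> fatou_set R"
    using open_fatou_set[of R] assms(1) by (auto simp: open_dist)
  obtain d2 where d2: "d2 > 0" "\<forall>f\<in>iterates (sphere_map R). \<forall>y\<in>fatou_set R.
      dist y x < d2 \<longrightarrow> dist (f y) (f x) < e"
    using equicontinuous_on_fatou_set[of R] assms unfolding equicontinuous_on_def by meson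
  show ?thesis
    using d1 d2 by (intro exI[of _ "min d1 d2"]) (auto simp: iterates_def)
qed

lemma fatou_setI:
  assumes "open U" "x \<in> U"
    and "\<And>x e. x \<in> U \<Longrightarrow> e > 0 \<Longrightarrow> \<exists>d>0. \<forall>y\<in>U. dist y x < d \<longrightarrow>
           (\<forall>m. dist ((sphere_map R ^^ m) y) ((sphere_map R ^^ m) x) < e)"
  shows "x \<in> fatou_set R"
proof -
  have "equicontinuous_on U (iterates (sphere_map R))"
    unfolding equicontinuous_on_def iterates_def using assms(3) by fast
  then show ?thesis unfolding fatou_set_def using assms(1,2) by blast
qed

text \<open>Pulling back: after one continuous step, the later iterates are controlled by the
  equicontinuity at the image point.\<close>

lemma fatou_set_preimage:
  assumes V: "open V" "x \<in> V" and cont: "continuous_on V (sphere_map R)"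
    and img: "sphere_map R x \<in> fatou_set R"
  shows "x \<in> fatou_set R"
proof (rule fatou_setI)
  let ?f = "sphere_map R"
  let ?U = "V \<inter> ?f -` fatou_set R"
  show "open ?U"
    using continuous_open_preimage[OF cont V(1) open_fatou_set] by simp
  show "x \<in> ?U" using V img by simp
  fix y and e :: real assume y: "y \<in> ?U" and e: "e > 0"
  obtain d1 where d1: "d1 > 0" "\<And>z m. dist z (?f y) < d1 \<Longrightarrow>
      dist ((?f ^^ m) z) ((?f ^^ m) (?f y)) < e"
    using fatou_setD[of "?f y" R e] y e by auto
  obtain d2 where d2: "d2 > 0" "\<And>z. z \<in> V \<Longrightarrow> dist z y < d2 \<Longrightarrow> dist (?f z) (?f y) < d1"
    using cont y d1(1) unfolding continuous_on_iff by blast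
  show "\<exists>d>0. \<forall>z\<in>?U. dist z y < d \<longrightarrow> (\<forall>m. dist ((?f ^^ m) z) ((?f ^^ m) y) < e)"
  proof (intro exI[of _ "min e d2"] conjI ballI impI allI)
    fix z m assume z: "z \<in> ?U" "dist z y < min e d2"
    show "dist ((?f ^^ m) z) ((?f ^^ m) y) < e"
    proof (cases m)
      case (Suc k)
      then show ?thesis using z d1(2)[OF d2(2), of z k] by (simp add: funpow_Suc_right del: funpow.simps)
    qed (use z in simp)
  qed (use e d2 in simp)
qed

text \<open>Pushing forward: openness lets nearby points of the image be lifted to nearby points
  of the domain.\<close>

lemma fatou_set_image:
  assumes V: "open V" "x \<in> V" and op: "\<And>U. open U \<Longrightarrow> U \<subseteq> V \<Longrightarrow> open (sphere_map R ` U)"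
    and x: "x \<in> fatou_set R"
  shows "sphere_map R x \<in> fatou_set R"
proof (rule fatou_setI)
  let ?f = "sphere_map R"
  let ?W = "?f ` (V \<inter> fatou_set R)"
  show "open ?W" using V by (intro op) (auto intro: open_fatou_set)
  show "?f x \<in> ?W" using V x by blast
  fix y and e :: real assume "y \<in> ?W" and e: "e > 0"
  then obtain u where u: "u \<in> V" "u \<in> fatou_set R" "y = ?f u" by blast
  obtain d where d: "d > 0" "\<And>z m. dist z u < d \<Longrightarrow> dist ((?f ^^ m) z) ((?f ^^ m) u) < e"
    using fatou_setD[OF u(2) e] by blast
  have "open (?f ` (V \<inter> ball u d))" using V by (intro op) auto
  moreover have "y \<in> ?f ` (V \<inter> ball u d)" using u d by auto
  ultimately obtain d' where d': "d' > 0" "ball y d' \<subseteq> ?f ` (V \<inter> ball u d)"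
    using open_contains_ball by blast
  show "\<exists>d>0. \<forall>z\<in>?W. dist z y < d \<longrightarrow> (\<forall>m. dist ((?f ^^ m) z) ((?f ^^ m) y) < e)"
  proof (intro exI[of _ d'] conjI ballI impI allI)
    fix z m assume "dist z y < d'"
    then have "z \<in> ?f ` (V \<inter> ball u d)" using d'(2) by (auto simp: dist_commute)
    then obtain v where v: "dist v u < d" "z = ?f v" by (metis IntD2 dist_commute imageE mem_ball)
    show "dist ((?f ^^ m) z) ((?f ^^ m) y) < e"
      using d(2)[OF v(1), of "Suc m"] v u by (simp add: funpow_Suc_right del: funpow.simps)
  qed (use d' in simp)
qed

text \<open>Iterates that converge uniformly to a constant are equicontinuous: the tail is uniformly
  small and finitely many maps remain.\<close>

lemma fatou_set_uniform_basin:
  assumes U: "open U" "x \<in> U" and inv: "sphere_map R ` U \<subseteq> U"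
    and cont: "continuous_on U (sphere_map R)"
    and unif: "\<And>e. e > 0 \<Longrightarrow> \<exists>k. \<forall>m\<ge>k. \<forall>y\<in>U. dist ((sphere_map R ^^ m) y) c < e"
  shows "x \<in> fatou_set R"
proof (rule fatou_setI[OF U])
  let ?f = "sphere_map R"
  have stay: "(?f ^^ m) ` U \<subseteq> U" for m
    using inv by (induction m) auto
  have cont_m: "continuous_on U (?f ^^ m)" for m
  proof (induction m)
    case (Suc m)
    have "continuous_on U (?f \<circ> (?f ^^ m))"
      by (intro continuous_on_compose Suc continuous_on_subset[OF cont stay])
    then show ?case by (simp add: comp_def)
  qed (simp add: id_def)
  fix y and e :: real assume y: "y \<in> U" and e: "e > 0"
  obtain k where k: "\<And>m y. m \<ge> k \<Longrightarrow> y \<in> U \<Longrightarrow> dist ((?f ^^ m) y) c < e / 2"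
    using unif[of "e/2"] e by auto
  have "\<exists>d>0. \<forall>z\<in>U. dist z y < d \<longrightarrow> (\<forall>m<j. dist ((?f ^^ m) z) ((?f ^^ m) y) < e)" for j
  proof (induction j)
    case (Suc j)
    then obtain d where d: "d > 0" "\<forall>z\<in>U. dist z y < d \<longrightarrow> (\<forall>m<j. dist ((?f ^^ m) z) ((?f ^^ m) y) < e)"
      by blast
    obtain d' where "d' > 0" "\<forall>z\<in>U. dist z y < d' \<longrightarrow> dist ((?f ^^ j) z) ((?f ^^ j) y) < e"
      using cont_m[of j] y e unfolding continuous_on_iff by blast
    with d show ?case by (intro exI[of _ "min d d'"]) (auto simp: less_Suc_eq)
  qed (auto intro: exI[of _ 1])
  from this[of k] obtain d where d: "d > 0"
    "\<forall>z\<in>U. dist z y < d \<longrightarrow> (\<forall>m<k. dist ((?f ^^ m) z) ((?f ^^ m) y) < e)" by blast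
  show "\<exists>d>0. \<forall>z\<in>U. dist z y < d \<longrightarrow> (\<forall>m. dist ((?f ^^ m) z) ((?f ^^ m) y) < e)"
  proof (intro exI[of _ d] conjI ballI impI allI)
    fix z m assume z: "z \<in> U" "dist z y < d"
    show "dist ((?f ^^ m) z) ((?f ^^ m) y) < e"
    proof (cases "m < k")
      case False
      then show ?thesis
        using k[of m z] k[of m y] z y dist_triangle_half_l[of "(?f ^^ m) z" c e "(?f ^^ m) y"]
        by simp
    qed (use d z in blast)
  qed (rule d(1))
qed

text \<open>Convergence to an attracting fixed point is a locally constant property on the Fatou set:
  by equicontinuity, neighbouring orbits stay close forever, so if one of them enters a
  neighbourhood that is attracted to the fixed point, so does the other.\<close>

lemma fatou_set_connected_basin:
  assumes C: "connected X" "X \<subseteq> fatou_set R" and xy: "x \<in> X" "y \<in> X"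
    and N: "open N" "c \<in> N" "\<And>z. z \<in> N \<Longrightarrow> (\<lambda>m. (sphere_map R ^^ m) z) \<longlonglongrightarrow> c"
    and x: "(\<lambda>m. (sphere_map R ^^ m) x) \<longlonglongrightarrow> c"
  shows "(\<lambda>m. (sphere_map R ^^ m) y) \<longlonglongrightarrow> c"
proof -
  let ?f = "sphere_map R"
  obtain e where e: "e > 0" "ball c (3 * e) \<subseteq> N"
  proof -
    obtain e' where "e' > 0" "ball c e' \<subseteq> N" using N open_contains_ball by blast
    then show ?thesis using that[of "e'/3"] by simp
  qed
  have transfer: "(\<lambda>m. (?f ^^ m) v) \<longlonglongrightarrow> c"
    if u: "(\<lambda>m. (?f ^^ m) u) \<longlonglongrightarrow> c" and uv: "\<And>m. dist ((?f ^^ m) u) ((?f ^^ m) v) < 2 * e" for u v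
  proof -
    have "\<forall>\<^sub>F m in sequentially. dist ((?f ^^ m) u) c < e"
      using tendstoD[OF u e(1)] .
    then obtain m where m: "dist ((?f ^^ m) u) c < e" by (auto simp: eventually_sequentially)
    have "dist c ((?f ^^ m) v) < 3 * e"
      using m uv[of m] dist_triangle[of c "(?f ^^ m) v" "(?f ^^ m) u"] by (simp add: dist_commute)
    then have "(\<lambda>k. (?f ^^ k) ((?f ^^ m) v)) \<longlonglongrightarrow> c" using e(2) by (intro N(3)) auto
    then have "(\<lambda>k. (?f ^^ (k + m)) v) \<longlonglongrightarrow> c" by (simp add: funpow_add)
    then show ?thesis by (rule LIMSEQ_offset)
  qed
  show ?thesis
  proof (rule connected_induction_simple[OF C(1) xy, where P = "\<lambda>z. (\<lambda>m. (?f ^^ m) z) \<longlonglongrightarrow> c"])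
    fix a assume a: "a \<in> X"
    then obtain d where d: "d > 0" "\<And>y m. dist y a < d \<Longrightarrow> dist ((?f ^^ m) y) ((?f ^^ m) a) < e"
      using fatou_setD[of a R e] C(2) e(1) by blast
    show "\<exists>T. openin (top_of_set X) T \<and> a \<in> T \<and>
           (\<forall>u\<in>T. \<forall>v\<in>T. ((\<lambda>m. (?f ^^ m) u) \<longlonglongrightarrow> c) \<longrightarrow> ((\<lambda>m. (?f ^^ m) v) \<longlonglongrightarrow> c))"
    proof (intro exI[of _ "X \<inter> ball a d"] conjI ballI impI)
      show "openin (top_of_set X) (X \<inter> ball a d)" by (simp add: openin_open_Int)
      fix u v assume uv: "u \<in> X \<inter> ball a d" "v \<in> X \<inter> ball a d" and u: "(\<lambda>m. (?f ^^ m) u) \<longlonglongrightarrow> c"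
      show "(\<lambda>m. (?f ^^ m) v) \<longlonglongrightarrow> c"
      proof (rule transfer[OF u])
        fix m
        have "dist ((?f ^^ m) u) ((?f ^^ m) a) < e" "dist ((?f ^^ m) v) ((?f ^^ m) a) < e"
          using uv by (auto intro!: d(2) simp: dist_commute[of a])
        then show "dist ((?f ^^ m) u) ((?f ^^ m) v) < 2 * e"
          using dist_triangle2[of "(?f ^^ m) u" "(?f ^^ m) v" "(?f ^^ m) a"] by simp
      qed
    qed (use a d in auto)
  qed (rule x)
qed

section \<open>Symmetries that commute with the map\<close>

lemma fatou_set_commuting_isometry:
  assumes iso: "\<And>x y. dist (h x) (h y) = dist x y"
    and isog: "\<And>x y. dist (g x) (g y) = dist x y" "\<And>x. h (g x) = x" "\<And>x. g (h x) = x"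
    and comm: "\<And>x. sphere_map R (h x) = h (sphere_map R x)"
    and x: "x \<in> fatou_set R"
  shows "h x \<in> fatou_set R"
proof (rule fatou_setI)
  let ?f = "sphere_map R"
  have comm_m: "(?f ^^ m) (h y) = h ((?f ^^ m) y)" for m y
    by (induction m) (simp_all add: comm)
  let ?U = "g -` fatou_set R"
  have "continuous_on UNIV g"
    unfolding continuous_on_iff isog(1) by blast
  then show "open ?U" using open_fatou_set open_vimage by blast
  show "h x \<in> ?U" using x isog by simp
  fix y and e :: real assume y: "y \<in> ?U" and e: "e > 0"
  obtain d where d: "d > 0" "\<And>z m. dist z (g y) < d \<Longrightarrow> dist ((?f ^^ m) z) ((?f ^^ m) (g y)) < e"
    using fatou_setD[of "g y" R e] y e by auto
  show "\<exists>d>0. \<forall>z\<in>?U. dist z y < d \<longrightarrow> (\<forall>m. dist ((?f ^^ m) z) ((?f ^^ m) y) < e)"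
  proof (intro exI[of _ d] conjI ballI impI allI)
    fix z m assume "dist z y < d"
    then have "dist ((?f ^^ m) (g z)) ((?f ^^ m) (g y)) < e" using d(2) isog(1) by simp
    then have "dist ((?f ^^ m) (h (g z))) ((?f ^^ m) (h (g y))) < e" by (simp only: comm_m iso)
    then show "dist ((?f ^^ m) z) ((?f ^^ m) y) < e" by (simp add: isog)
  qed (rule d(1))
qed

text \<open>Rotations about the origin are isometries of the chordal metric.\<close>

lemma rotation_mem_symmetry_group:
  assumes l: "cmod l = 1"
    and comm: "\<And>x. sphere_map R (extend_to_sphere (\<lambda>z. l * z) x) =
                  extend_to_sphere (\<lambda>z. l * z) (sphere_map R x)"
  shows "(\<lambda>z. l * z) \<in> symmetry_group R"
proof -
  let ?h = "extend_to_sphere (\<lambda>z. l * z)" and ?g = "extend_to_sphere (\<lambda>z. inverse l * z)"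
  have l0: "l \<noteq> 0" using l by auto
  have iso: "dist (extend_to_sphere (\<lambda>z. a * z) x) (extend_to_sphere (\<lambda>z. a * z) y) = dist x y"
    if "cmod a = 1" for a x y
    using that by (cases x; cases y)
      (simp_all add: dist_Cplx_Cplx dist_Cplx_Infty dist_commute[of Infty] norm_mult
         flip: right_diff_distrib)
  have hg: "?h (?g x) = x" "?g (?h x) = x" for x
    using l0 by (cases x; simp)+
  have inv: "cmod (inverse l) = 1" using l by (simp add: norm_inverse)
  have commg: "sphere_map R (?g x) = ?g (sphere_map R x)" for x
    using comm[of "?g x"] hg by metis
  have "?h ` julia_set R = julia_set R"
  proof (intro equalityI subsetI)
    fix y assume "y \<in> ?h ` julia_set R"
    then obtain x where x: "x \<in> julia_set R" "y = ?h x" by blast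
    have "?g y \<in> fatou_set R" if "y \<in> fatou_set R"
      by (rule fatou_set_commuting_isometry[where h = ?g and g = ?h])
        (use that iso[OF l] iso[OF inv] hg commg in simp_all)
    then show "y \<in> julia_set R" using x hg by (auto simp: julia_set_def)
  next
    fix y assume y: "y \<in> julia_set R"
    have "y \<in> fatou_set R" if "?g y \<in> fatou_set R"
    proof -
      have "?h (?g y) \<in> fatou_set R"
        by (rule fatou_set_commuting_isometry[where h = ?h and g = ?g])
          (use that iso[OF l] iso[OF inv] hg comm in simp_all)
      then show ?thesis using hg by simp
    qed
    then have "?g y \<in> julia_set R" using y by (auto simp: julia_set_def)
    then show "y \<in> ?h ` julia_set R" using hg by (metis imageI)
  qed
  then show ?thesis unfolding symmetry_group_def using l by (intro CollectI conjI exI[of _ l] exI[of _ 0]) auto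
qed

text \<open>Since \<^const>\<open>Infty\<close> is fixed by every extended affine map, only the finite part of the Julia
  set matters.\<close>

lemma symmetry_group_julia_iff:
  assumes "s \<in> symmetry_group R"
  shows "Cplx (s z) \<in> julia_set R \<longleftrightarrow> Cplx z \<in> julia_set R"
proof -
  obtain a b where ab: "cmod a = 1" "s = (\<lambda>z. a * z + b)"
    and J: "extend_to_sphere s ` julia_set R = julia_set R"
    using assms unfolding symmetry_group_def by blast
  have inj: "s z = s w \<Longrightarrow> z = w" for z w using ab by auto
  show ?thesis
  proof
    assume "Cplx (s z) \<in> julia_set R"
    then obtain x where x: "x \<in> julia_set R" "Cplx (s z) = extend_to_sphere s x" using J by blast
    then show "Cplx z \<in> julia_set R" using inj by (cases x) auto
  next
    assume "Cplx z \<in> julia_set R"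
    then have "extend_to_sphere s (Cplx z) \<in> julia_set R" using J by blast
    then show "Cplx (s z) \<in> julia_set R" by simp
  qed
qed

section \<open>Maps that are asymptotically linear at infinity\<close>

text \<open>Here \<open>E\<close>, a function of the local coordinate \<open>1 / u\<close> at infinity, is the
  deviation from the linear contraction \<open>u \<mapsto> K u\<close>.\<close>

locale asymptotically_linear =
  fixes K r M :: real and E :: "complex \<Rightarrow> complex"
  assumes K: "0 < K" "K < 1" and r: "r > 0" and M: "M \<ge> 0"
    and lip: "\<And>w w'. cmod w \<le> r \<Longrightarrow> cmod w' \<le> r \<Longrightarrow> cmod (E w - E w') \<le> M * cmod (w - w')"
begin

definition Q :: "complex \<Rightarrow> complex" where
  "Q u = of_real K * u + E (1 / u)"

lemma inverse_le_r: "cmod u \<ge> 1 / r \<Longrightarrow> cmod (1 / u) \<le> r"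
  using r by (simp add: norm_divide divide_le_eq mult.commute split: if_splits)

lemma E_near_limit: "cmod u \<ge> 1 / r \<Longrightarrow> cmod (E (1 / u) - E 0) \<le> M / cmod u"
  using lip[of "1/u" 0] inverse_le_r[of u] r by (simp add: norm_divide)

text \<open>An orbit that starts at \<open>y\<close> far away stays close to \<open>K ^ i y\<close> if \<open>E\<close> vanishes at
  infinity.  Hence a set invariant under \<open>Q\<close> and under a translation contains, on each scale
  \<open>K ^ j\<close>, copies of the translation lattice whose mesh tends to \<open>0\<close>, and so it comes near every
  far point of the ray spanned by the translation.\<close>

lemma translation_invariant_meets_ray:
  assumes S: "\<And>u. u \<in> S \<Longrightarrow> cmod u \<ge> 1 / r \<Longrightarrow> Q u \<in> S"
    and b: "\<And>u. u \<in> S \<Longrightarrow> u + b \<in> S" "b \<noteq> 0" and x: "x \<in> S" and E0: "E 0 = 0" and e: "e > 0"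
  shows "\<exists>N. \<forall>k\<ge>N. \<exists>y\<in>S. cmod (y - of_nat k * b) < e"
proof -
  define h where "h = (1 - K) * e / 2"
  have h: "h > 0" using K e by (simp add: h_def)
  define rho where "rho = max (1 / r) (M / h)"
  have rho: "rho > 0" using r by (simp add: rho_def less_max_iff_disj)
  have err: "cmod (Q y - of_real K * y) \<le> h" if "cmod y \<ge> rho" for y
  proof -
    have y: "cmod y \<ge> 1 / r" "M / h \<le> cmod y" "cmod y > 0"
      using that rho unfolding rho_def by linarith+
    have "cmod (Q y - of_real K * y) \<le> M / cmod y"
      using E_near_limit[OF y(1)] by (simp add: Q_def E0)
    also have "\<dots> \<le> h" using y h by (simp add: field_simps)
    finally show ?thesis .
  qed
  obtain N :: nat where N: "real N > (rho + e) / cmod b" using reals_Archimedean2 by blast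
  have "\<exists>y\<in>S. cmod (y - of_nat k * b) < e" if k: "k \<ge> N" for k
  proof -
    have kb: "real k * cmod b \<ge> rho + e"
    proof -
      have "(rho + e) / cmod b \<le> real k" using N k by linarith
      then show ?thesis using b(2) by (simp add: field_simps)
    qed
    have "(\<lambda>j. K ^ j * (cmod x + cmod b)) \<longlonglongrightarrow> 0 * (cmod x + cmod b)"
      using K by (intro tendsto_mult LIMSEQ_power_zero tendsto_const) auto
    then have "\<forall>\<^sub>F j in sequentially. K ^ j * (cmod x + cmod b) < e / 2"
      using e by (intro order_tendstoD(2)) auto
    then obtain j where j: "K ^ j * (cmod x + cmod b) < e / 2" by (auto simp: eventually_sequentially)
    have Kj: "K ^ j > 0" using K by simp
    \<comment> \<open>the translate of \<open>x\<close> that \<open>j\<close> linear steps bring close to \<open>k b\<close>\<close>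
    define i0 where "i0 = nat \<lfloor>real k / K ^ j\<rfloor>"
    have i0: "\<bar>real i0 - real k / K ^ j\<bar> \<le> 1"
    proof -
      have "real k / K ^ j \<ge> 0" using K by simp
      then show ?thesis unfolding i0_def by linarith
    qed
    define y0 where "y0 = x + of_nat i0 * b"
    have y0: "y0 \<in> S"
    proof -
      have "x + of_nat i * b \<in> S" for i
        by (induction i) (use x b(1)[of "x + of_nat _ * b"] in \<open>auto simp: algebra_simps\<close>)
      then show ?thesis by (simp add: y0_def)
    qed
    have near: "cmod (of_real (K ^ j) * y0 - of_nat k * b) < e / 2"
    proof -
      have "of_real (K ^ j) * y0 - of_nat k * b
          = of_real (K ^ j) * (x + of_real (real i0 - real k / K ^ j) * b)"
        using K by (simp add: y0_def algebra_simps)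
      then have "cmod (of_real (K ^ j) * y0 - of_nat k * b)
          = K ^ j * cmod (x + of_real (real i0 - real k / K ^ j) * b)"
        using K by (simp add: norm_mult norm_power)
      also have "\<dots> \<le> K ^ j * (cmod x + cmod b)"
      proof (intro mult_left_mono)
        have "cmod (of_real (real i0 - real k / K ^ j) * b) \<le> 1 * cmod b"
          unfolding norm_mult norm_of_real using i0 by (intro mult_right_mono) auto
        then show "cmod (x + of_real (real i0 - real k / K ^ j) * b) \<le> cmod x + cmod b"
          using norm_triangle_ineq[of x "of_real (real i0 - real k / K ^ j) * b"] by simp
      qed (use Kj in simp)
      finally show ?thesis using j by simp
    qed
    have "(Q ^^ i) y0 \<in> S \<and> cmod ((Q ^^ i) y0 - of_real (K ^ i) * y0) \<le> e / 2" if "i \<le> j" for i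
      using that
    proof (induction i)
      case 0
      then show ?case using y0 e by simp
    next
      case (Suc i)
      define y where "y = (Q ^^ i) y0"
      have y: "y \<in> S" "cmod (y - of_real (K ^ i) * y0) \<le> e / 2"
        using Suc by (simp_all add: y_def)
      have "cmod (of_nat k * b) \<le> cmod (of_real (K ^ j) * y0) + e / 2"
        using near norm_triangle_ineq2[of "of_nat k * b" "of_real (K ^ j) * y0"]
        by (simp add: norm_minus_commute)
      moreover have "cmod (of_real (K ^ j) * y0) \<le> cmod (of_real (K ^ i) * y0)"
        using K Suc.prems power_decreasing[of i j K] by (simp add: norm_mult norm_power mult_right_mono)
      moreover have "cmod (of_real (K ^ i) * y0) \<le> cmod y + e / 2"
        using y(2) norm_triangle_ineq2[of "of_real (K ^ i) * y0" y] by (simp add: norm_minus_commute)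
      ultimately have big: "cmod y \<ge> rho" using kb by (simp add: norm_mult)
      then have "Q y \<in> S" using S[OF y(1)] by (simp add: rho_def)
      moreover have "cmod (Q y - of_real (K ^ Suc i) * y0) \<le> e / 2"
      proof -
        have "Q y - of_real (K ^ Suc i) * y0
            = (Q y - of_real K * y) + of_real K * (y - of_real (K ^ i) * y0)"
          by (simp add: algebra_simps)
        then have "cmod (Q y - of_real (K ^ Suc i) * y0) \<le>
            cmod (Q y - of_real K * y) + cmod (of_real K * (y - of_real (K ^ i) * y0))"
          using norm_triangle_ineq by metis
        also have "\<dots> \<le> h + K * (e / 2)"
        proof (rule add_mono[OF err[OF big]])
          show "cmod (of_real K * (y - of_real (K ^ i) * y0)) \<le> K * (e / 2)"
            unfolding norm_mult norm_of_real using K y(2) by (intro mult_mono) auto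
        qed
        also have "\<dots> = e / 2" by (simp add: h_def field_simps)
        finally show ?thesis .
      qed
      ultimately show ?case by (simp add: y_def)
    qed
    from this[of j] have *: "(Q ^^ j) y0 \<in> S" "cmod ((Q ^^ j) y0 - of_real (K ^ j) * y0) \<le> e / 2"
      by simp_all
    have "cmod ((Q ^^ j) y0 - of_nat k * b) < e"
      using norm_triangle_ineq[of "(Q ^^ j) y0 - of_real (K ^ j) * y0" "of_real (K ^ j) * y0 - of_nat k * b"]
        near *(2) by simp
    then show ?thesis using *(1) by blast
  qed
  then show ?thesis by blast
qed

text \<open>If \<open>Q\<close> preserves the real axis, a closed forward invariant set that misses a real ray
  misses a sector around it.  Far out, \<open>Q\<close> is a contraction with a factor that is so close to
  \<open>K\<close> that the relative distance to the real axis, measured by \<open>\<bar>y - x\<bar> / (x + c)\<close> for a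
  suitable constant \<open>c\<close>, never grows; the orbit of a point of a thin sector thus stays close to
  a real orbit until it reaches a compact real interval, which has a positive
  distance from the set.\<close>

lemma sector_avoids:
  assumes S: "\<And>u. u \<in> S \<Longrightarrow> cmod u \<ge> 1 / r \<Longrightarrow> Q u \<in> S" and cl: "closed S"
    and real: "\<And>x::real. x \<ge> R0 \<Longrightarrow> Im (Q (of_real x)) = 0"
    and ray: "\<And>x::real. x \<ge> R0 \<Longrightarrow> of_real x \<notin> S"
  shows "\<exists>d>0. \<exists>N. \<forall>x>N. \<forall>y. cmod (y - of_real x) \<le> d * x \<longrightarrow> y \<notin> S"
proof -
  define B where "B = cmod (E 0) + M * r"
  have B: "B \<ge> 0" using M r by (simp add: B_def)
  have EB: "cmod (E (1 / u)) \<le> B" if "cmod u \<ge> 1 / r" for u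
  proof -
    have "cmod (E (1 / u) - E 0) \<le> M * cmod (1 / u)"
      using lip[of "1/u" 0] inverse_le_r[OF that] r by simp
    also have "\<dots> \<le> M * r" using inverse_le_r[OF that] M by (rule mult_left_mono)
    finally show ?thesis
      using norm_triangle_ineq2[of "E (1/u)" "E 0"] by (simp add: B_def)
  qed
  \<comment> \<open>chosen such that \<open>(K + 2 M / x\<^sup>2) (x + c) \<le> K x - B + c\<close> for \<open>x \<ge> R\<close>\<close>
  define c where "c = 2 * (2 * M + B) / (1 - K)"
  have c: "c \<ge> 0" "2 * M + B = c * (1 - K) / 2" using K M B by (simp_all add: c_def)
  define R where "R = max (max R0 1) (max (max (2 / r) c) (4 * M / (1 - K)))"
  have R: "R \<ge> R0" "R \<ge> 1" "R \<ge> 2 / r" "R \<ge> c" "R \<ge> 4 * M / (1 - K)"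
    by (auto simp: R_def)
  \<comment> \<open>real orbits descend below \<open>r2\<close> by steps of length at least \<open>1\<close> and cannot jump over \<open>[R, r2]\<close>\<close>
  define r2 where "r2 = max ((R + B) / K) ((B + 1) / (1 - K))"
  have r2: "K * r2 \<ge> R + B" "(1 - K) * r2 \<ge> B + 1"
  proof -
    have "(R + B) / K \<le> r2" "(B + 1) / (1 - K) \<le> r2" by (simp_all add: r2_def)
    then show "K * r2 \<ge> R + B" "(1 - K) * r2 \<ge> B + 1"
      using K by (simp_all add: field_simps)
  qed
  have r2pos: "r2 > 0"
    using r2(1) R(2) B K by (smt (verit, best) mult_nonneg_nonpos)
  obtain h where h: "h > 0" "\<And>x y. x \<in> complex_of_real ` {R..r2} \<Longrightarrow> y \<in> S \<Longrightarrow> h \<le> dist x y"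
  proof -
    have 1: "compact (complex_of_real ` {R..r2})"
      by (intro compact_continuous_image continuous_intros) auto
    have 2: "complex_of_real ` {R..r2} \<inter> S = {}" using ray R by auto
    show ?thesis using separate_compact_closed[OF 1 cl 2] that by metis
  qed
  define d where "d = min (1 / 4) (h / (2 * (r2 + c)))"
  have d: "d > 0" "d \<le> 1 / 4" "d * (r2 + c) < h"
  proof -
    have p: "r2 + c > 0" using r2pos c by simp
    show "d > 0" using h(1) p by (simp add: d_def)
    show "d \<le> 1 / 4" unfolding d_def by (rule min.cobounded1)
    have "d * (r2 + c) \<le> h / (2 * (r2 + c)) * (r2 + c)"
      using p by (intro mult_right_mono) (simp_all add: d_def)
    also have "\<dots> = h / 2" using p by (simp add: field_simps)
    also have "\<dots> < h" using h(1) by simp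
    finally show "d * (r2 + c) < h" .
  qed
  have main: "y \<notin> S" if "R \<le> x" "x \<le> r2 + real m" "cmod (y - of_real x) \<le> d * (x + c)" for m x y
    using that
  proof (induction m arbitrary: x y)
    case (Suc m)
    have base: "y \<notin> S" if "x \<le> r2"
    proof
      assume "y \<in> S"
      then have "h \<le> cmod (y - of_real x)"
        using h(2)[of "of_real x" y] that Suc.prems by (simp add: dist_norm norm_minus_commute)
      also have "\<dots> \<le> d * (r2 + c)"
        using Suc.prems(3) that d(1) by (smt (verit) mult_left_mono)
      finally show False using d by simp
    qed
    show ?case
    proof (cases "x \<le> r2")
      case False
      have x: "x \<ge> 1" "x \<ge> R0" "x \<ge> 2 / r" using Suc.prems(1) R by auto
      have "d * (x + c) \<le> 1 / 4 * (x + x)"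
        using d R(4) Suc.prems(1) c(1) x by (intro mult_mono) auto
      then have yx: "cmod (y - of_real x) \<le> x / 2" using Suc.prems(3) by simp
      have y2: "cmod y \<ge> x / 2"
        using yx norm_triangle_ineq3[of y "of_real x"] x by simp
      have yr: "cmod y \<ge> 1 / r" using y2 x(3) by simp
      have xr: "cmod (of_real x) \<ge> 1 / r" using x r by (simp add: field_simps)
      define x' where "x' = Re (Q (of_real x))"
      have x': "Q (of_real x) = of_real x'"
        using real[OF x(2)] by (simp add: x'_def complex_eq_iff)
      have diff: "\<bar>x' - K * x\<bar> \<le> B"
      proof -
        have "cmod (of_real x' - of_real (K * x)) \<le> B"
          using EB[OF xr] unfolding x'[symmetric] by (simp add: Q_def)
        then show ?thesis unfolding of_real_diff[symmetric] norm_of_real .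
      qed
      have "x' \<ge> R"
        using diff r2(1) False K by (smt (verit, best) mult_left_mono)
      moreover have "x' \<le> r2 + real m"
      proof -
        have "(1 - K) * r2 \<le> (1 - K) * x" using False K by (intro mult_left_mono) auto
        then show ?thesis using diff r2(2) Suc.prems(2) by (simp add: algebra_simps)
      qed
      moreover have "cmod (Q y - of_real x') \<le> d * (x' + c)"
      proof -
        define D where "D = cmod (y - of_real x)"
        have y0: "y \<noteq> 0" using y2 x by auto
        have "cmod (1 / y - 1 / of_real x) = D / (cmod y * x)"
          using y0 x by (simp add: D_def norm_divide norm_mult diff_frac_eq norm_minus_commute)
        also have "\<dots> \<le> D / (x / 2 * x)"
          using y2 x by (intro divide_left_mono mult_right_mono mult_pos_pos) (auto simp: D_def)
        finally have inv: "cmod (1 / y - 1 / of_real x) \<le> 2 * D / x\<^sup>2"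
          by (simp add: power2_eq_square mult.commute)
        have "Q y - of_real x' = of_real K * (y - of_real x) + (E (1 / y) - E (1 / of_real x))"
          unfolding x'[symmetric] by (simp add: Q_def algebra_simps)
        then have "cmod (Q y - of_real x') \<le>
            cmod (of_real K * (y - of_real x)) + cmod (E (1 / y) - E (1 / of_real x))"
          using norm_triangle_ineq by metis
        also have "\<dots> \<le> K * D + M * (2 * D / x\<^sup>2)"
        proof (intro add_mono)
          show "cmod (E (1 / y) - E (1 / of_real x)) \<le> M * (2 * D / x\<^sup>2)"
            using lip[OF inverse_le_r[OF yr] inverse_le_r[OF xr]] mult_left_mono[OF inv M] by simp
        qed (use K in \<open>simp add: norm_mult D_def\<close>)
        also have "\<dots> = D * (K + 2 * M / x\<^sup>2)" by (simp add: algebra_simps)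
        also have "\<dots> \<le> d * (x + c) * (K + 2 * M / x\<^sup>2)"
          using Suc.prems(3) K M by (intro mult_right_mono) (auto simp: D_def)
        also have "\<dots> \<le> d * (x' + c)"
        proof -
          have "2 * M / x\<^sup>2 \<le> 2 * M / x"
            using x M by (intro divide_left_mono) (auto simp: power2_eq_square)
          moreover have "2 * M / x \<le> (1 - K) / 2"
          proof -
            have "4 * M / (1 - K) \<le> x" using R(5) Suc.prems(1) by simp
            then have "4 * M \<le> x * (1 - K)" using K by (simp add: pos_divide_le_eq)
            then have "2 * M \<le> (1 - K) / 2 * x" by (simp add: mult.commute)
            then show ?thesis using x by (simp add: pos_divide_le_eq)
          qed
          ultimately have 1: "2 * M / x\<^sup>2 \<le> (1 - K) / 2" by simp
          have 2: "2 * M / x \<le> 2 * M" using x M by (simp add: divide_le_eq mult_le_cancel_left1)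
          have "(x + c) * (K + 2 * M / x\<^sup>2) = K * x + 2 * M / x + c * (K + 2 * M / x\<^sup>2)"
          proof -
            have "x * (2 * M / x\<^sup>2) = 2 * M / x" using x by (simp add: power2_eq_square)
            then show ?thesis unfolding distrib_right distrib_left by (simp add: mult.commute)
          qed
          also have "\<dots> \<le> K * x + 2 * M + c * (K + (1 - K) / 2)"
            using 1 2 c(1) K by (intro add_mono mult_left_mono) auto
          also have "\<dots> = K * x - B + c" using c(2) by (simp add: field_simps)
          also have "\<dots> \<le> x' + c" using diff by simp
          finally show ?thesis using d(1) by (simp add: mult.assoc)
        qed
        finally show ?thesis .
      qed
      ultimately have "Q y \<notin> S" by (rule Suc.IH)
      then show ?thesis using S yr by blast
    qed (rule base)
  next
    case 0
    show ?case
    proof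
      assume "y \<in> S"
      then have "h \<le> cmod (y - of_real x)"
        using h(2)[of "of_real x" y] 0 by (simp add: dist_norm norm_minus_commute)
      also have "\<dots> \<le> d * (r2 + c)"
        using 0 d(1) by (smt (verit) mult_left_mono of_nat_0)
      finally show False using d by simp
    qed
  qed
  show ?thesis
  proof (rule exI[of _ d], intro conjI exI[of _ R] allI impI)
    fix x y assume xy: "x > R" "cmod (y - of_real x) \<le> d * x"
    obtain m where "x \<le> r2 + real m"
      using real_arch_simple[of "x - r2"] by (auto simp: algebra_simps)
    moreover have "cmod (y - of_real x) \<le> d * (x + c)"
      using xy d(1) c(1) by (smt (verit) mult_left_mono)
    ultimately show "y \<notin> S" using xy(1) by (intro main[of x m]) auto
  qed (rule d(1))
qed

end

section \<open>Asymptotic directions of an unbounded set\<close>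

text \<open>The blow-down of a set at infinity: the directions in which it contains arbitrarily
  distant points, up to sublinear errors.\<close>

definition asymptotic_cone :: "complex set \<Rightarrow> complex set" where
  "asymptotic_cone S = {w. \<forall>e>0. \<forall>N. \<exists>t>N. \<exists>u\<in>S. cmod (u - of_real t * w) < e * t}"

lemma asymptotic_coneD:
  assumes "w \<in> asymptotic_cone S" "e > 0"
  obtains t u where "t > N" "u \<in> S" "cmod (u - of_real t * w) < e * t"
  using assms unfolding asymptotic_cone_def by blast

lemma asymptotic_cone_nonempty:
  assumes S: "\<And>N. \<exists>u\<in>S. cmod u > N"
  obtains w where "w \<in> asymptotic_cone S" "cmod w = 1"
proof -
  obtain u where u: "\<And>i::nat. u i \<in> S" "\<And>i. cmod (u i) > real i"
  proof -
    have "\<forall>i::nat. \<exists>u. u \<in> S \<and> cmod u > real i" using S by blast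
    then show ?thesis using that by metis
  qed
  have "\<And>i. sgn (u i) \<in> sphere 0 1"
    using u(2) by (metis mem_sphere_0 norm_sgn norm_zero not_less of_nat_0_le_iff)
  then obtain w f where w: "w \<in> sphere 0 1" "strict_mono f" "((\<lambda>i. sgn (u i)) \<circ> f) \<longlonglongrightarrow> w"
    using compact_sphere[of "0::complex" 1] unfolding compact_def by meson
  show ?thesis
  proof (rule that)
    show "w \<in> asymptotic_cone S"
      unfolding asymptotic_cone_def
    proof (intro CollectI allI impI)
      fix e N :: real assume e: "e > 0"
      have "\<forall>\<^sub>F i in sequentially. dist (sgn (u (f i))) w < e"
        using tendstoD[OF w(3) e] by (simp add: comp_def)
      moreover obtain i0 :: nat where i0: "real i0 > N" using reals_Archimedean2 by blast
      moreover have "\<forall>\<^sub>F i in sequentially. i \<ge> i0" by (rule eventually_ge_at_top)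
      ultimately have "\<forall>\<^sub>F i in sequentially. dist (sgn (u (f i))) w < e \<and> i \<ge> i0"
        by (intro eventually_conj)
      then obtain i where i: "cmod (sgn (u (f i)) - w) < e" "i \<ge> i0"
        by (auto simp: eventually_sequentially dist_norm)
      have big: "cmod (u (f i)) > real i"
        using u(2)[of "f i"] seq_suble[OF w(2), of i] by linarith
      then have pos: "cmod (u (f i)) > 0" using of_nat_0_le_iff[of i, where 'a = real] by linarith
      have "u (f i) - of_real (cmod (u (f i))) * w = of_real (cmod (u (f i))) * (sgn (u (f i)) - w)"
        using pos by (simp add: algebra_simps sgn_eq)
      then have "cmod (u (f i) - of_real (cmod (u (f i))) * w) = cmod (u (f i)) * cmod (sgn (u (f i)) - w)"
        by (simp add: norm_mult)
      also have "\<dots> < e * cmod (u (f i))" using i(1) pos by simp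
      finally show "\<exists>t>N. \<exists>u\<in>S. cmod (u - of_real t * w) < e * t"
        using i0 i(2) big u(1) by (intro exI[of _ "cmod (u (f i))"]) (auto intro!: bexI[of _ "u (f i)"])
    qed
  qed (use w in simp)
qed

lemma asymptotic_cone_closed:
  assumes "\<And>e. e > 0 \<Longrightarrow> \<exists>w'\<in>asymptotic_cone S. cmod (w' - w) < e"
  shows "w \<in> asymptotic_cone S"
  unfolding asymptotic_cone_def
proof (intro CollectI allI impI)
  fix e N :: real assume e: "e > 0"
  obtain w' where w': "w' \<in> asymptotic_cone S" "cmod (w' - w) < e / 2" using assms[of "e/2"] e by auto
  obtain t u where tu: "t > max N 0" "u \<in> S" "cmod (u - of_real t * w') < e / 2 * t"
    using asymptotic_coneD[OF w'(1), of "e/2" "max N 0"] e by auto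
  have "cmod (u - of_real t * w) \<le> cmod (u - of_real t * w') + cmod (of_real t * (w' - w))"
    using norm_triangle_ineq[of "u - of_real t * w'" "of_real t * (w' - w)"] by (simp add: algebra_simps)
  also have "cmod (of_real t * (w' - w)) \<le> t * (e / 2)"
    unfolding norm_mult using tu(1) w'(2) by (intro mult_mono) auto
  finally have "cmod (u - of_real t * w) < e * t" using tu(3) by (simp add: mult.commute)
  then show "\<exists>t>N. \<exists>u\<in>S. cmod (u - of_real t * w) < e * t"
    using tu by (intro exI[of _ t]) (auto intro!: bexI[of _ u])
qed

lemma asymptotic_cone_scale:
  assumes w: "w \<in> asymptotic_cone S" and c: "c > 0"
  shows "of_real c * w \<in> asymptotic_cone S"
  unfolding asymptotic_cone_def
proof (intro CollectI allI impI)
  fix e N :: real assume e: "e > 0"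
  obtain t u where tu: "t > N * c" "u \<in> S" "cmod (u - of_real t * w) < e / c * t"
    using asymptotic_coneD[OF w, of "e/c" "N * c"] e c by auto
  then show "\<exists>t>N. \<exists>u\<in>S. cmod (u - of_real t * (of_real c * w)) < e * t"
    using c by (intro exI[of _ "t / c"]) (auto intro!: bexI[of _ u] simp: field_simps)
qed

lemma asymptotic_cone_rotate:
  assumes w: "w \<in> asymptotic_cone S" and a: "cmod a = 1" "\<And>u. u \<in> S \<Longrightarrow> a * u \<in> S"
  shows "a * w \<in> asymptotic_cone S"
  unfolding asymptotic_cone_def
proof (intro CollectI allI impI)
  fix e N :: real assume e: "e > 0"
  obtain t u where tu: "t > N" "u \<in> S" "cmod (u - of_real t * w) < e * t"
    using asymptotic_coneD[OF w e] by metis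
  have "a * u - of_real t * (a * w) = a * (u - of_real t * w)" by (simp add: algebra_simps)
  then have "cmod (a * u - of_real t * (a * w)) < e * t" using tu(3) a(1) by (simp add: norm_mult)
  then show "\<exists>t>N. \<exists>u\<in>S. cmod (u - of_real t * (a * w)) < e * t" using tu a(2) by blast
qed

text \<open>The set is asymptotically invariant under the translation by \<open>s\<close>.\<close>

definition drift :: "complex set \<Rightarrow> complex \<Rightarrow> bool" where
  "drift S s \<longleftrightarrow> (\<forall>h>0. \<exists>\<rho>. \<forall>u\<in>S. cmod u \<ge> \<rho> \<longrightarrow> (\<exists>v\<in>S. cmod (v - u - s) \<le> h))"

lemma drift_rotate:
  assumes d: "drift S s" and a: "cmod a = 1" "\<And>u. a * u \<in> S \<longleftrightarrow> u \<in> S"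
  shows "drift S (a * s)"
  unfolding drift_def
proof (intro allI impI)
  fix h :: real assume "h > 0"
  then obtain \<rho> where \<rho>: "\<And>u. u \<in> S \<Longrightarrow> cmod u \<ge> \<rho> \<Longrightarrow> \<exists>v\<in>S. cmod (v - u - s) \<le> h"
    using d unfolding drift_def by blast
  have a0: "a \<noteq> 0" using a(1) by auto
  show "\<exists>\<rho>. \<forall>u\<in>S. cmod u \<ge> \<rho> \<longrightarrow> (\<exists>v\<in>S. cmod (v - u - a * s) \<le> h)"
  proof (intro exI[of _ \<rho>] ballI impI)
    fix u assume u: "u \<in> S" "cmod u \<ge> \<rho>"
    obtain v where v: "v \<in> S" "cmod (v - u / a - s) \<le> h"
      using \<rho>[of "u / a"] u a(1) a(2)[of "u / a"] a0 by (auto simp: norm_divide)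
    have "a * v - u - a * s = a * (v - u / a - s)" using a0 by (simp add: field_simps)
    then have "cmod (a * v - u - a * s) \<le> h" using v(2) a(1) by (simp add: norm_mult)
    then show "\<exists>v\<in>S. cmod (v - u - a * s) \<le> h" using v(1) a(2) by blast
  qed
qed

text \<open>Following the drift for a time proportional to the distance moves a point of the set by
  a macroscopic amount, with sublinear accumulated error, as long as the path stays away
  from the origin.\<close>

lemma asymptotic_cone_translate:
  assumes w: "w \<in> asymptotic_cone S" and d: "drift S s"
    and seg: "\<And>x. 0 \<le> x \<Longrightarrow> x \<le> 1 \<Longrightarrow> w + of_real x * s \<noteq> 0"
  shows "w + s \<in> asymptotic_cone S"
  unfolding asymptotic_cone_def
proof (intro CollectI allI impI)
  fix e N :: real assume e: "e > 0"
  have "compact ((\<lambda>x. w + of_real x * s) ` {0..1})"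
    by (intro compact_continuous_image continuous_intros) auto
  moreover have "0 \<notin> (\<lambda>x. w + of_real x * s) ` {0..1}" using seg by fastforce
  ultimately obtain m where m: "m > 0" "\<forall>y\<in>(\<lambda>x. w + of_real x * s) ` {0..1}. m \<le> dist 0 y"
    using separate_point_closed compact_imp_closed by metis
  define h where "h = min (e / 4) (m / 4)"
  have h: "h > 0" "h \<le> e / 4" "h \<le> m / 4" using e m(1) by (auto simp: h_def)
  obtain \<rho> where \<rho>: "\<And>u. u \<in> S \<Longrightarrow> cmod u \<ge> \<rho> \<Longrightarrow> \<exists>v\<in>S. cmod (v - u - s) \<le> h"
    using d h(1) unfolding drift_def by blast
  obtain t u where tu: "t > max (max N 0) (max (2 * \<rho> / m) (2 * cmod s / e))" "u \<in> S"
      "cmod (u - of_real t * w) < h * t"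
    using asymptotic_coneD[OF w h(1)] by metis
  have t: "t > N" "t > 0" "2 * \<rho> / m < t" "2 * cmod s / e < t" using tu(1) by auto
  have t': "2 * \<rho> < t * m" "2 * cmod s < t * e" using t(3,4) m(1) e by (simp_all add: field_simps)
  define j where "j = nat \<lfloor>t\<rfloor>"
  have j: "real j \<le> t" "t < real j + 1" using t(2) unfolding j_def by linarith+
  have "\<exists>v\<in>S. cmod (v - of_real t * w - of_nat i * s) \<le> h * t + real i * h" if "i \<le> j" for i
    using that
  proof (induction i)
    case 0
    then show ?case using tu by (auto intro!: bexI[of _ u])
  next
    case (Suc i)
    then obtain v where v: "v \<in> S" "cmod (v - of_real t * w - of_nat i * s) \<le> h * t + real i * h" by auto
    have it: "real i \<le> t" using Suc.prems j by linarith
    have "w + of_real (real i / t) * s \<in> (\<lambda>x. w + of_real x * s) ` {0..1}"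
      using it t(2) by (intro imageI) simp
    then have "m \<le> cmod (w + of_real (real i / t) * s)"
      using m(2) by (metis dist_0_norm)
    then have "t * m \<le> cmod (of_real t * (w + of_real (real i / t) * s))"
      using t(2) by (simp add: norm_mult)
    also have "of_real t * (w + of_real (real i / t) * s) = of_real t * w + of_nat i * s"
      using t(2) by (simp add: distrib_left)
    finally have 1: "t * m \<le> cmod (of_real t * w + of_nat i * s)" .
    have "real i * h \<le> t * h" using it h(1) by simp
    moreover have "t * h \<le> t * (m / 4)" using h(3) t(2) by (intro mult_left_mono) auto
    ultimately have 2: "cmod (v - of_real t * w - of_nat i * s) \<le> t * m / 2"
      using v(2) by (simp add: mult.commute)
    have "cmod (of_real t * w + of_nat i * s) \<le> cmod v + t * m / 2"
      using 2 norm_triangle_ineq2[of "of_real t * w + of_nat i * s" v]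
      by (simp add: norm_minus_commute diff_diff_eq)
    then have "cmod v \<ge> \<rho>" using 1 t'(1) by simp
    then obtain v' where v': "v' \<in> S" "cmod (v' - v - s) \<le> h" using \<rho> v(1) by blast
    have "v' - of_real t * w - of_nat (Suc i) * s = (v' - v - s) + (v - of_real t * w - of_nat i * s)"
      by (simp add: algebra_simps)
    then have "cmod (v' - of_real t * w - of_nat (Suc i) * s) \<le> h + (h * t + real i * h)"
      using norm_triangle_mono[OF v'(2) v(2)] by metis
    then show ?case using v'(1) by (auto intro!: bexI[of _ v'] simp: algebra_simps)
  qed
  from this[of j] obtain v where v: "v \<in> S" "cmod (v - of_real t * w - of_nat j * s) \<le> h * t + real j * h"
    by auto
  have "real j * h \<le> t * h" using j h(1) by simp
  moreover have "h * t \<le> e / 4 * t" using h(2) t(2) by (intro mult_right_mono) auto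
  ultimately have 1: "cmod (v - of_real t * w - of_nat j * s) \<le> e * t / 2"
    using v(2) by (simp add: mult.commute)
  have "cmod (of_real (real j - t) * s) \<le> 1 * cmod s"
    unfolding norm_mult norm_of_real using j by (intro mult_right_mono) auto
  then have 2: "cmod (of_real (real j - t) * s) < e * t / 2" using t'(2) by (simp add: mult.commute)
  have "cmod ((v - of_real t * w - of_nat j * s) + of_real (real j - t) * s) < e * t"
    using norm_triangle_ineq[of "v - of_real t * w - of_nat j * s" "of_real (real j - t) * s"] 1 2
    by linarith
  also have "(v - of_real t * w - of_nat j * s) + of_real (real j - t) * s = v - of_real t * (w + s)"
    by (simp add: algebra_simps)
  finally have "cmod (v - of_real t * (w + s)) < e * t" .
  then show "\<exists>t>N. \<exists>u\<in>S. cmod (u - of_real t * (w + s)) < e * t" using t(1) v(1) by blast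
qed

text \<open>A line that misses the origin is swept out completely; the cone property
  turns the unit time of the previous lemma into an arbitrary one.\<close>

lemma asymptotic_cone_line:
  assumes w: "w \<in> asymptotic_cone S" and d: "drift S s" "drift S (- s)" and s: "s \<noteq> 0" "Im (w / s) \<noteq> 0"
  shows "w + of_real c * s \<in> asymptotic_cone S"
proof -
  have pos: "w + of_real c * q \<in> asymptotic_cone S"
    if q: "drift S q" "q \<noteq> 0" "Im (w / q) \<noteq> 0" and c: "c > 0" for q c
  proof -
    have "of_real (1 / c) * w + q \<in> asymptotic_cone S"
    proof (rule asymptotic_cone_translate[OF asymptotic_cone_scale[OF w] q(1)])
      fix x :: real
      show "of_real (1 / c) * w + of_real x * q \<noteq> 0"
      proof
        assume "of_real (1 / c) * w + of_real x * q = 0"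
        then have "w / q = of_real (- (c * x))"
          using q(2) c by (simp add: field_simps eq_neg_iff_add_eq_0)
        then show False using q(3) by (metis Im_complex_of_real)
      qed
    qed (use c in simp)
    then have "of_real c * (of_real (1 / c) * w + q) \<in> asymptotic_cone S"
      using c by (rule asymptotic_cone_scale)
    then show ?thesis using c by (simp add: algebra_simps)
  qed
  consider "c > 0" | "c = 0" | "c < 0" by linarith
  then show ?thesis
  proof cases
    case 1
    then show ?thesis using pos[of s c] d s by blast
  next
    case 3
    then show ?thesis using pos[of "- s" "- c"] d s by simp
  qed (use w in simp)
qed

text \<open>Far along the line \<open>w + c s\<close>, the direction approaches \<open>\<plusminus>s\<close>.\<close>

lemma asymptotic_cone_contains_drift:
  assumes w: "w \<in> asymptotic_cone S" and d: "drift S s" "drift S (- s)" and s: "s \<noteq> 0" "Im (w / s) \<noteq> 0"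
  shows "s \<in> asymptotic_cone S"
proof (rule asymptotic_cone_closed)
  fix e :: real assume e: "e > 0"
  define c where "c = (cmod w + 1) / e"
  have c: "c > 0" "cmod w < c * e" using e by (simp_all add: c_def add_nonneg_pos)
  have "of_real (1 / c) * (w + of_real c * s) \<in> asymptotic_cone S"
    using c by (intro asymptotic_cone_scale asymptotic_cone_line[OF w d s]) auto
  moreover have "of_real (1 / c) * (w + of_real c * s) - s = w / of_real c"
    using c by (simp add: distrib_left)
  moreover have "cmod (w / of_real c) < e"
    using c by (simp add: norm_divide pos_divide_less_eq mult.commute)
  ultimately show "\<exists>w'\<in>asymptotic_cone S. cmod (w' - s) < e" by metis
qed

text \<open>Two independent drifts, each available in both directions, reach every direction: one of them
  is transverse to \<open>w\<close>, which gives its own direction, and from there the other one sweeps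
  out a half plane.\<close>

lemma asymptotic_cone_all:
  assumes w: "w \<in> asymptotic_cone S" "w \<noteq> 0"
    and s: "drift S s" "drift S (- s)" "s \<noteq> 0" and q: "drift S q" "drift S (- q)" "q \<noteq> 0"
    and indep: "Im (q / s) \<noteq> 0" and z: "z \<noteq> 0"
  shows "z \<in> asymptotic_cone S"
proof -
  have main: "z \<in> asymptotic_cone S"
    if s: "drift S s" "drift S (- s)" "s \<noteq> 0" and q: "drift S q" "drift S (- q)" "q \<noteq> 0"
      and indep: "Im (q / s) \<noteq> 0" and ws: "Im (w / s) \<noteq> 0" for s q
  proof -
    have sq: "Im (s / q) \<noteq> 0"
      using indep Reals_inverse[of "s / q"] unfolding complex_is_Real_iff by auto
    have S: "s \<in> asymptotic_cone S"
      by (rule asymptotic_cone_contains_drift[OF w(1) s ws])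
    have S': "- s \<in> asymptotic_cone S"
      by (rule asymptotic_cone_contains_drift[OF w(1)]) (use s ws in simp_all)
    have Q: "q \<in> asymptotic_cone S"
      by (rule asymptotic_cone_contains_drift[OF S q sq])
    have Q': "- q \<in> asymptotic_cone S"
      by (rule asymptotic_cone_contains_drift[OF S]) (use q sq in simp_all)
    define b where "b = Im (z / s) / Im (q / s)"
    define a where "a = Re (z / s) - b * Re (q / s)"
    have "z / s = of_real a + of_real b * (q / s)"
    proof -
      have "b * Im (q / s) = Im (z / s)" using indep by (simp add: b_def)
      then show ?thesis unfolding complex_eq_iff
        by (simp add: a_def del: Re_divide Im_divide times_divide_eq_right)
    qed
    then have "z / s * s = (of_real a + of_real b * (q / s)) * s" by (rule arg_cong)
    then have zab: "z = of_real a * s + of_real b * q" using s(3) by (simp add: distrib_right)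
    consider "a > 0" | "a < 0" | "a = 0" "b > 0" | "a = 0" "b < 0" | "a = 0" "b = 0" by linarith
    then show ?thesis
    proof cases
      case 1
      have "of_real a * (s + of_real (b / a) * q) \<in> asymptotic_cone S"
        by (intro asymptotic_cone_scale asymptotic_cone_line S q sq 1)
      then show ?thesis using 1 by (simp add: zab distrib_left)
    next
      case 2
      have "of_real (- a) * (- s + of_real (b / (- a)) * q) \<in> asymptotic_cone S"
        by (intro asymptotic_cone_scale asymptotic_cone_line S' q) (use sq 2 in simp_all)
      then show ?thesis using 2 by (simp add: zab right_diff_distrib)
    next
      case 3
      then show ?thesis using asymptotic_cone_scale[OF Q, of b] by (simp add: zab)
    next
      case 4
      then show ?thesis using asymptotic_cone_scale[OF Q', of "- b"] by (simp add: zab)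
    qed (use z zab in simp)
  qed
  show ?thesis
  proof (cases "Im (w / s) = 0")
    case True
    then obtain c where c: "w / s = of_real c" by (metis complex_is_Real_iff Reals_cases)
    then have "w = of_real c * s" using s(3) by (simp add: field_simps)
    moreover from this have "c \<noteq> 0" using w(2) by auto
    ultimately have "w / q = of_real c * (s / q)" "c \<noteq> 0" by simp_all
    then have "Im (w / q) = c * Im (s / q)" "c \<noteq> 0" by (metis Im_complex_of_real Re_complex_of_real add.right_neutral mult_zero_left times_complex.sel(2))+
    moreover have sq: "Im (s / q) \<noteq> 0"
      using indep Reals_inverse[of "s / q"] unfolding complex_is_Real_iff by auto
    ultimately show ?thesis using main[OF q s sq] by simp
  qed (use main[OF s q indep] in blast)
qed

section \<open>Rotations preserving an invariant set of an asymptotically linear map\<close>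

context asymptotically_linear
begin

lemma continuous_on_E: "continuous_on (cball 0 r) E"
proof (rule continuous_onI)
  fix x :: complex and e :: real assume xe: "x \<in> cball 0 r" "e > 0"
  show "\<exists>d>0. \<forall>x'\<in>cball 0 r. dist x' x < d \<longrightarrow> dist (E x') (E x) \<le> e"
  proof (intro exI[of _ "e / (M + 1)"] conjI ballI impI)
    fix y assume y: "y \<in> cball 0 r" "dist y x < e / (M + 1)"
    have "dist (E y) (E x) \<le> M * dist y x" using lip[of y x] xe y by (simp add: dist_norm)
    also have "\<dots> \<le> (M + 1) * dist y x" by (intro mult_right_mono) auto
    also have "\<dots> \<le> e" using y(2) M by (simp add: field_simps)
    finally show "dist (E y) (E x) \<le> e" .
  qed (use xe M in simp)
qed

text \<open>The maps \<open>Q\<close> and \<open>u \<mapsto> Q (a u) / a\<close> agree to first order at infinity but have different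
  constant terms.  Solving \<open>Q (a v) = a Q u\<close> for \<open>v\<close> near \<open>u\<close> therefore moves \<open>u\<close>
  by a nearly constant amount, and it preserves every set that is invariant
  under both maps.\<close>

lemma rotation_drift:
  assumes a: "cmod a = 1" "\<And>u. a * u \<in> S \<longleftrightarrow> u \<in> S"
    and S: "\<And>u. cmod u \<ge> 1 / r \<Longrightarrow> Q u \<in> S \<longleftrightarrow> u \<in> S"
  shows "drift S ((1 - inverse a) * E 0 / of_real K)"
  unfolding drift_def
proof (intro allI impI)
  let ?s = "(1 - inverse a) * E 0 / of_real K"
  fix h :: real assume h: "h > 0"
  have a0: "a \<noteq> 0" using a(1) by auto
  have ia: "cmod (inverse a) = 1" using a(1) by (simp add: norm_inverse)
  define P where "P = max (1 / r) (2 * M / (K * h))"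
  have P: "P \<ge> 1 / r" "P \<ge> 2 * M / (K * h)" by (simp_all add: P_def)
  have Ppos: "P > 0" using P(1) r by (smt (verit) divide_pos_pos)
  have small: "M / cmod u \<le> K * h / 2" if "cmod u \<ge> P" for u
  proof -
    have "2 * M / (K * h) \<le> cmod u" "cmod u > 0" using that P(2) Ppos by auto
    then show ?thesis using K h by (simp add: field_simps)
  qed
  show "\<exists>\<rho>. \<forall>u\<in>S. cmod u \<ge> \<rho> \<longrightarrow> (\<exists>v\<in>S. cmod (v - u - ?s) \<le> h)"
  proof (intro exI[of _ "P + cmod ?s + h"] ballI impI)
    fix u assume u: "u \<in> S" "cmod u \<ge> P + cmod ?s + h"
    have uP: "cmod u \<ge> P" using u(2) h norm_ge_zero[of ?s] by linarith
    define F where "F v = u + (E (1 / u) - inverse a * E (1 / (a * v))) / of_real K" for v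
    have vP: "cmod v \<ge> P" if "v \<in> cball (u + ?s) h" for v
    proof -
      have "cmod (u + ?s) \<le> cmod v + h"
        using that norm_triangle_ineq2[of "u + ?s" v] by (simp add: dist_norm)
      moreover have "cmod u \<le> cmod (u + ?s) + cmod ?s"
        using norm_triangle_ineq4[of "u + ?s" ?s] by simp
      ultimately show ?thesis using u(2) by linarith
    qed
    have "\<exists>v\<in>cball (u + ?s) h. F v = v"
    proof (rule brouwer)
      have "continuous_on (cball (u + ?s) h) (\<lambda>v. E (1 / (a * v)))"
      proof (rule continuous_on_compose2[OF continuous_on_E])
        show "continuous_on (cball (u + ?s) h) (\<lambda>v. 1 / (a * v))"
          using vP Ppos a0 by (intro continuous_intros) fastforce
        show "(\<lambda>v. 1 / (a * v)) ` cball (u + ?s) h \<subseteq> cball 0 r"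
        proof (rule image_subsetI)
          fix v assume "v \<in> cball (u + ?s) h"
          then have "cmod (a * v) \<ge> 1 / r" using vP P(1) a(1) by (fastforce simp: norm_mult)
          then show "1 / (a * v) \<in> cball 0 r" using inverse_le_r by simp
        qed
      qed
      then show "continuous_on (cball (u + ?s) h) F"
        unfolding F_def using K by (intro continuous_intros) auto
      show "F \<in> cball (u + ?s) h \<rightarrow> cball (u + ?s) h"
      proof
        fix v assume v: "v \<in> cball (u + ?s) h"
        have 1: "cmod (E (1 / u) - E 0) \<le> K * h / 2"
          using E_near_limit[of u] small[OF uP] uP P(1) by linarith
        have "cmod (E (1 / (a * v)) - E 0) \<le> M / cmod (a * v)"
          using vP[OF v] P(1) a(1) by (intro E_near_limit) (simp add: norm_mult)
        also have "\<dots> \<le> K * h / 2" using small[of "a * v"] vP[OF v] a(1) by (simp add: norm_mult)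
        finally have 2: "cmod (inverse a * (E (1 / (a * v)) - E 0)) \<le> K * h / 2"
          using ia by (simp only: norm_mult)
        have "F v - (u + ?s) = ((E (1 / u) - E 0) - inverse a * (E (1 / (a * v)) - E 0)) / of_real K"
          by (simp add: F_def diff_divide_distrib add_divide_distrib algebra_simps)
        then have "cmod (F v - (u + ?s)) = cmod ((E (1 / u) - E 0) - inverse a * (E (1 / (a * v)) - E 0)) / K"
          using K by (simp add: norm_divide)
        also have "\<dots> \<le> (K * h / 2 + K * h / 2) / K"
          using K norm_triangle_ineq4[of "E (1 / u) - E 0" "inverse a * (E (1 / (a * v)) - E 0)"] 1 2
          by (intro divide_right_mono) linarith+
        also have "\<dots> = h" using K by simp
        finally show "F v \<in> cball (u + ?s) h" by (simp add: dist_norm norm_minus_commute)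
      qed
    qed (use h in auto)
    then obtain v where v: "v \<in> cball (u + ?s) h" "F v = v" by blast
    have "Q (a * v) = a * Q u"
    proof -
      have "of_real K * a * v = of_real K * a * F v" using v(2) by simp
      also have "\<dots> = of_real K * a * u + a * E (1 / u) - E (1 / (a * v))"
        using K a0 by (simp add: F_def field_simps)
      finally show ?thesis by (simp add: Q_def algebra_simps)
    qed
    moreover have "a * Q u \<in> S" using a(2) S[of u] u(1) uP P(1) by simp
    ultimately have "a * v \<in> S" using S[of "a * v"] vP[OF v(1)] P(1) a(1) by (simp add: norm_mult)
    then have "v \<in> S" using a(2) by blast
    moreover have "cmod (v - u - ?s) \<le> h"
      using v(1) by (simp add: dist_norm norm_minus_commute algebra_simps)
    ultimately show "\<exists>v\<in>S. cmod (v - u - ?s) \<le> h" by blast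
  qed
qed

text \<open>If \<open>a \<noteq> 1\<close>, the drifts \<open>\<plusminus>s\<close> and \<open>\<plusminus>a s\<close> with \<open>s = (1 - 1 / a) E 0 / K\<close> carry
  any asymptotic direction to the positive real one: when \<open>a\<close> is not real they
  span the plane, and when \<open>a = -1\<close> they are real and the asymptotic cone is symmetric.\<close>

theorem rotation_trivial:
  assumes a: "cmod a = 1" "\<And>u. a * u \<in> S \<longleftrightarrow> u \<in> S"
    and S: "\<And>u. cmod u \<ge> 1 / r \<Longrightarrow> Q u \<in> S \<longleftrightarrow> u \<in> S" and cl: "closed S"
    and unbdd: "\<And>N. \<exists>u\<in>S. cmod u > N"
    and E0: "E 0 = of_real e0" "e0 \<noteq> 0"
    and real: "\<And>x::real. x \<ge> R0 \<Longrightarrow> Im (Q (of_real x)) = 0"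
    and ray: "\<And>x::real. x \<ge> R0 \<Longrightarrow> of_real x \<notin> S"
  shows "a = 1"
proof (rule ccontr)
  assume a1: "a \<noteq> 1"
  have a0: "a \<noteq> 0" using a(1) by auto
  have ia: "cmod (inverse a) = 1" "\<And>u. inverse a * u \<in> S \<longleftrightarrow> u \<in> S"
    using a(1) a(2)[of "inverse a * _"] a0 by (simp_all add: norm_inverse flip: mult.assoc)
  have one: "1 \<notin> asymptotic_cone S"
  proof
    assume one: "1 \<in> asymptotic_cone S"
    obtain d N where d: "d > 0" "\<And>x y. x > N \<Longrightarrow> cmod (y - of_real x) \<le> d * x \<Longrightarrow> y \<notin> S"
      using sector_avoids[of S R0, OF _ cl real ray] S by blast
    obtain t u where "t > N" "u \<in> S" "cmod (u - of_real t * 1) < d * t"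
      using asymptotic_coneD[OF one d(1)] by metis
    then show False using d(2)[of t u] by simp
  qed
  obtain w where w: "w \<in> asymptotic_cone S" "cmod w = 1"
    using asymptotic_cone_nonempty[OF unbdd] by blast
  define s where "s = (1 - inverse a) * E 0 / of_real K"
  have s0: "s \<noteq> 0" using a1 a0 E0 K by (simp add: s_def field_simps)
  have s: "drift S s" unfolding s_def by (rule rotation_drift[OF a S])
  have "drift S (inverse a * ((1 - inverse (inverse a)) * E 0 / of_real K))"
    by (intro drift_rotate ia rotation_drift S)
  also have "inverse a * ((1 - inverse (inverse a)) * E 0 / of_real K) = - s"
    using a0 by (simp add: s_def algebra_simps flip: minus_divide_left add: diff_divide_distrib)
  finally have s': "drift S (- s)" .
  show False
  proof (cases "Im a = 0")
    case False
    have "drift S (a * s)" "drift S (- (a * s))"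
      using drift_rotate[OF s a] drift_rotate[OF s' a] by simp_all
    moreover have "Im (a * s / s) \<noteq> 0" "a * s \<noteq> 0" "w \<noteq> 0" using False s0 a0 w(2) by auto
    ultimately have "1 \<in> asymptotic_cone S"
      using asymptotic_cone_all[OF w(1) _ s s' s0, of "a * s"] by simp
    then show False using one by blast
  next
    case True
    then have am: "a = -1"
      using a(1) a1 by (auto simp: complex_eq_iff cmod_def abs_if split: if_splits)
    define x where "x = 2 * e0 / K"
    have sx: "s = of_real x" using am E0(1) by (simp add: s_def x_def)
    have x0: "x \<noteq> 0" using sx s0 by auto
    show False
    proof (cases "Im w = 0")
      case True
      then have "w = 1 \<or> w = -1"
        using w(2) by (auto simp: complex_eq_iff cmod_def abs_if split: if_splits)
      then have "w = 1 \<or> a * w = 1" using am by auto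
      then show False using one w(1) asymptotic_cone_rotate[OF w(1) a(1)] a(2) by metis
    next
      case False
      have "s \<in> asymptotic_cone S"
        by (rule asymptotic_cone_contains_drift[OF w(1) s s' s0]) (use False sx x0 in simp)
      moreover have "- s \<in> asymptotic_cone S"
        by (rule asymptotic_cone_contains_drift[OF w(1)]) (use s s' s0 False sx x0 in simp_all)
      ultimately have "of_real (1 / \<bar>x\<bar>) * s \<in> asymptotic_cone S" "of_real (1 / \<bar>x\<bar>) * (- s) \<in> asymptotic_cone S"
        using x0 by (intro asymptotic_cone_scale; simp)+
      then have "1 \<in> asymptotic_cone S" using x0 sx by (cases "x > 0") (simp_all add: abs_if)
      then show False using one by blast
    qed
  qed
qed

end

section \<open>Symmetries of polynomial Julia sets\<close>

lemma sphere_map_poly: "sphere_map (to_fract p) (Cplx z) = Cplx (poly p z)"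
  using sphere_map_Fract(1)[of p 1 z] by (simp add: to_fract_def)

lemma sphere_map_poly_iterate: "(sphere_map (to_fract p) ^^ m) (Cplx z) = Cplx ((poly p ^^ m) z)"
  by (induction m) (simp_all add: sphere_map_poly)

text \<open>If \<open>|f| \<le> M\<close> on the lemniscate domain \<open>|P| \<le> R\<close> of a monic \<open>P\<close>, then
  \<open>f ^ degree P / P ^ degree f\<close> is holomorphic outside, also at infinity, where it takes the value
  \<open>lead_coeff f ^ degree P\<close>; the maximum principle applies in the coordinate \<open>1 / z\<close>.\<close>

lemma lead_coeff_bound_lemniscate:
  fixes P f :: "complex poly"
  assumes P: "lead_coeff P = 1" "degree P > 0" and R: "R \<ge> 1" "cmod (poly P 0) < R"
    and f: "\<And>z. cmod (poly P z) \<le> R \<Longrightarrow> cmod (poly f z) \<le> M"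
  shows "cmod (lead_coeff f) \<le> M"
proof -
  define N where "N = degree P"
  define m where "m = degree f"
  have M: "M \<ge> 0" using f[of 0] R by (meson less_imp_le norm_ge_zero order_trans)
  define \<Omega> where "\<Omega> = {w. cmod (poly (reflect_poly P) w) > R * cmod w ^ N}"
  have rP: "poly (reflect_poly P) w = w ^ N * poly P (inverse w)" if "w \<noteq> 0" for w
    using that by (simp add: poly_reflect_poly_nz N_def)
  have rf: "poly (reflect_poly f) w = w ^ m * poly f (inverse w)" if "w \<noteq> 0" for w
    using that by (simp add: poly_reflect_poly_nz m_def)
  have op: "open \<Omega>" unfolding \<Omega>_def by (intro open_Collect_less continuous_intros)
  have cl: "closure \<Omega> \<subseteq> {w. cmod (poly (reflect_poly P) w) \<ge> R * cmod w ^ N}"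
  proof (rule closure_minimal)
    show "closed {w. cmod (poly (reflect_poly P) w) \<ge> R * cmod w ^ N}"
      by (intro closed_Collect_le continuous_intros)
  qed (auto simp: \<Omega>_def)
  have nz: "poly (reflect_poly P) w \<noteq> 0" if "w \<in> closure \<Omega>" for w
  proof (cases "w = 0")
    case False
    then have "R * cmod w ^ N > 0" using R by simp
    then show ?thesis using cl that by fastforce
  qed (use P in simp)
  have bd: "bounded \<Omega>"
  proof -
    have "continuous (at 0) (\<lambda>z. cmod (poly P z))" by (intro continuous_intros)
    then have "\<forall>\<^sub>F z in at 0. cmod (poly P z) < R"
      using R(2) unfolding isCont_def by (rule order_tendstoD)
    then obtain e where e: "e > 0" "\<And>z. z \<noteq> 0 \<Longrightarrow> cmod z < e \<Longrightarrow> cmod (poly P z) < R"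
      unfolding eventually_at by (auto simp: dist_norm)
    have "cmod w \<le> 1 / e" if "w \<in> \<Omega>" for w
    proof (rule ccontr)
      assume "\<not> cmod w \<le> 1 / e"
      then have w: "cmod w > 1 / e" by simp
      then have w0: "w \<noteq> 0" using e(1) by auto
      have "cmod (inverse w) < e" using w w0 e(1) by (simp add: norm_inverse norm_divide inverse_eq_divide pos_divide_less_eq mult.commute)
      then have "cmod (poly P (inverse w)) < R" using e(2)[of "inverse w"] w0 by simp
      moreover have "R * cmod w ^ N < cmod w ^ N * cmod (poly P (inverse w))"
        using that rP[OF w0] by (simp add: \<Omega>_def norm_mult norm_power)
      ultimately show False using w0 by (simp add: mult.commute)
    qed
    then show ?thesis by (intro boundedI)
  qed
  define H where "H w = poly (reflect_poly f) w ^ N / poly (reflect_poly P) w ^ m" for w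
  have "cmod (H 0) \<le> M ^ N"
  proof (rule maximum_modulus_frontier[of H \<Omega>])
    show "H holomorphic_on interior \<Omega>"
      unfolding H_def using nz closure_subset[of \<Omega>] interior_subset[of \<Omega>]
      by (intro holomorphic_intros) auto
    show "continuous_on (closure \<Omega>) H"
      unfolding H_def using nz by (intro continuous_intros) auto
    show "0 \<in> \<Omega>" using P R by (simp add: \<Omega>_def N_def power_0_left)
    fix w assume "w \<in> frontier \<Omega>"
    then have "w \<in> closure \<Omega>" "w \<notin> \<Omega>" using op by (auto simp: frontier_def interior_open)
    then have eq: "cmod (poly (reflect_poly P) w) = R * cmod w ^ N"
      using cl by (auto simp: \<Omega>_def)
    have w0: "w \<noteq> 0" using eq P by (auto simp: N_def power_0_left)
    then have PR: "cmod (poly P (inverse w)) = R" using eq rP[OF w0] by (simp add: norm_mult norm_power)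
    have "cmod (H w) = cmod (poly f (inverse w)) ^ N / R ^ m"
      using w0 PR by (simp add: H_def rP rf norm_divide norm_mult norm_power power_mult_distrib
          mult.commute flip: power_mult)
    also have "\<dots> \<le> M ^ N / 1"
      using f[of "inverse w"] PR M R(1) by (intro frac_le power_mono) auto
    finally show "cmod (H w) \<le> M ^ N" by simp
  qed (rule bd)
  then have "cmod (lead_coeff f) ^ N \<le> M ^ N"
    using P by (simp add: H_def norm_power)
  then show ?thesis
    using power_mono_iff[of "cmod (lead_coeff f)" M N] M P by (simp add: N_def)
qed

text \<open>Centring puts the barycentre of the roots, about which all symmetries rotate, at the origin, and
  \<open>poly p 0 = 0\<close> puts the origin inside the lemniscate of every iterate.\<close>

locale centred_polynomial =
  fixes p :: "complex poly" and R :: real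
  assumes monic: "lead_coeff p = 1" and deg: "degree p \<ge> 2"
    and centred: "coeff p (degree p - 1) = 0" and zero: "poly p 0 = 0"
    and R: "R \<ge> 1" and escape: "\<And>z. cmod z > R \<Longrightarrow> cmod (poly p z) \<ge> 2 * cmod z"
begin

definition filled_julia :: "complex set" where
  "filled_julia = {z. \<forall>m. cmod ((poly p ^^ m) z) \<le> R}"

lemma escape_iterate:
  assumes "cmod z > R"
  shows "cmod ((poly p ^^ m) z) \<ge> 2 ^ m * cmod z"
proof (induction m)
  case (Suc m)
  have "1 * cmod z \<le> 2 ^ m * cmod z" by (intro mult_right_mono) auto
  then have "cmod ((poly p ^^ m) z) > R" using Suc assms by linarith
  then show ?case using escape[of "(poly p ^^ m) z"] Suc by simp
qed simp

lemma unbounded_orbit: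
  assumes "z \<notin> filled_julia"
  shows "\<exists>m. cmod ((poly p ^^ m) z) > B"
proof -
  obtain k where k: "cmod ((poly p ^^ k) z) > R" using assms by (auto simp: filled_julia_def not_le)
  obtain m :: nat where m: "B < 2 ^ m" using real_arch_pow[of 2 B] by auto
  have "2 ^ m * 1 \<le> 2 ^ m * cmod ((poly p ^^ k) z)" using k R by (intro mult_left_mono) auto
  also have "\<dots> \<le> cmod ((poly p ^^ m) ((poly p ^^ k) z))" using escape_iterate[OF k] .
  finally show ?thesis using m by (intro exI[of _ "m + k"]) (simp add: funpow_add)
qed

lemma continuous_on_sphere_map: "continuous_on (range Cplx) (sphere_map (to_fract p))"
proof -
  have "continuous_on (range Cplx) (\<lambda>x. Cplx (poly p (affine_part x)))"
    by (intro continuous_on_compose2[OF continuous_on_Cplx[of UNIV]] continuous_intros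
        continuous_on_subset[OF continuous_on_affine_part]) auto
  then show ?thesis by (rule continuous_on_eq) (auto simp: sphere_map_poly)
qed

lemma julia_subset_filled_julia:
  assumes "Cplx z \<in> julia_set (to_fract p)"
  shows "z \<in> filled_julia"
proof (rule ccontr)
  let ?f = "sphere_map (to_fract p)"
  let ?W = "Cplx ` {z. cmod z > R}"
  assume "z \<notin> filled_julia"
  then obtain k where k: "cmod ((poly p ^^ k) z) > R" by (auto simp: filled_julia_def not_le)
  have W: "open ?W" by (intro open_Cplx_image open_Collect_less continuous_intros)
  have basin: "x \<in> fatou_set (to_fract p)" if x: "x \<in> ?W" for x
  proof (rule fatou_set_uniform_basin[OF W x, where c = Infty])
    show "?f ` ?W \<subseteq> ?W"
    proof
      fix y assume "y \<in> ?f ` ?W"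
      then obtain w where w: "cmod w > R" "y = Cplx (poly p w)" by (auto simp: sphere_map_poly)
      then have "cmod (poly p w) > R" using escape[OF w(1)] R by linarith
      then show "y \<in> ?W" using w by auto
    qed
    show "continuous_on ?W ?f" by (rule continuous_on_subset[OF continuous_on_sphere_map]) auto
    fix e :: real assume e: "e > 0"
    obtain k where k: "2 / e < 2 ^ k" using real_arch_pow[of 2 "2 / e"] by auto
    show "\<exists>k. \<forall>m\<ge>k. \<forall>y\<in>?W. dist ((?f ^^ m) y) Infty < e"
    proof (intro exI[of _ k] allI impI ballI)
      fix m y assume m: "m \<ge> k" and "y \<in> ?W"
      then obtain w where w: "cmod w > R" "y = Cplx w" by auto
      define v where "v = (poly p ^^ m) w"
      have "2 ^ k * 1 \<le> 2 ^ m * cmod w" using w(1) R m by (intro mult_mono power_increasing) auto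
      then have v: "cmod v > 2 / e" using k escape_iterate[OF w(1), of m] by (simp add: v_def)
      then have v0: "cmod v > 0" using e by (smt (verit) divide_pos_pos)
      have "cmod v \<le> sqrt (1 + (cmod v)\<^sup>2)" by (intro real_le_rsqrt) simp
      then have "2 / sqrt (1 + (cmod v)\<^sup>2) \<le> 2 / cmod v" using v0 by (intro frac_le) auto
      also have "\<dots> < e" using v v0 e by (simp add: field_simps)
      finally show "dist ((?f ^^ m) y) Infty < e"
        by (simp add: w sphere_map_poly_iterate dist_Cplx_Infty v_def)
    qed
  qed
  have "Cplx z \<in> fatou_set (to_fract p)" if "cmod ((poly p ^^ k) z) > R" for k z
    using that
  proof (induction k arbitrary: z)
    case 0
    then show ?case using basin by auto
  next
    case (Suc k)
    then have "?f (Cplx z) \<in> fatou_set (to_fract p)"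
      by (simp add: sphere_map_poly funpow_Suc_right del: funpow.simps)
    then show ?case
      by (rule fatou_set_preimage[OF open_Cplx_image[OF open_UNIV] rangeI continuous_on_sphere_map])
  qed
  then show False using k assms by (auto simp: julia_set_def)
qed

text \<open>Equicontinuity near a point with bounded orbit keeps the neighbouring orbits away from
  infinity, hence bounded.\<close>

lemma frontier_filled_julia:
  assumes z: "z \<in> filled_julia" "z \<notin> interior filled_julia"
  shows "Cplx z \<in> julia_set (to_fract p)"
proof (rule ccontr)
  let ?f = "sphere_map (to_fract p)"
  assume "Cplx z \<notin> julia_set (to_fract p)"
  then have F: "Cplx z \<in> fatou_set (to_fract p)" by (simp add: julia_set_def)
  define c where "c = 2 / sqrt (1 + R\<^sup>2)"
  have c: "c > 0" by (simp add: c_def add_pos_nonneg)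
  obtain d where d: "d > 0" "\<And>y m. dist y (Cplx z) < d \<Longrightarrow> dist ((?f ^^ m) y) ((?f ^^ m) (Cplx z)) < c / 2"
    using fatou_setD[OF F, of "c/2"] c by auto
  have "ball z (d / 2) \<subseteq> filled_julia"
  proof
    fix y assume y: "y \<in> ball z (d / 2)"
    have dy: "dist (Cplx y) (Cplx z) < d"
      using dist_Cplx_le[of y z] y by (simp add: dist_norm norm_minus_commute)
    have "cmod ((poly p ^^ m) y) \<le> 4 / c" for m
    proof -
      define u v where "u = (poly p ^^ m) z" and "v = (poly p ^^ m) y"
      have "cmod u \<le> R" using z by (simp add: filled_julia_def u_def)
      then have "c \<le> 2 / sqrt (1 + (cmod u)\<^sup>2)"
        unfolding c_def by (intro divide_left_mono real_sqrt_le_mono add_mono power_mono mult_pos_pos)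
          (auto simp: add_pos_nonneg)
      then have "c \<le> dist (Cplx u) Infty" by (simp add: dist_Cplx_Infty)
      moreover have "dist (Cplx v) (Cplx u) < c / 2"
        using d(2)[OF dy, of m] by (simp add: sphere_map_poly_iterate u_def v_def)
      ultimately have "c / 2 < dist (Cplx v) Infty"
        using dist_triangle3[of "Cplx u" Infty "Cplx v"] by linarith
      then have v: "c / 2 < 2 / sqrt (1 + (cmod v)\<^sup>2)" by (simp add: dist_Cplx_Infty)
      have p: "sqrt (1 + (cmod v)\<^sup>2) > 0" by (simp add: add_pos_nonneg)
      have "c / 2 * sqrt (1 + (cmod v)\<^sup>2) < 2" using v p by (simp only: pos_less_divide_eq)
      then have "sqrt (1 + (cmod v)\<^sup>2) \<le> 4 / c" using c by (simp add: field_simps)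
      moreover have "cmod v \<le> sqrt (1 + (cmod v)\<^sup>2)" by (intro real_le_rsqrt) simp
      ultimately show ?thesis by (simp add: v_def)
    qed
    then show "y \<in> filled_julia" using unbounded_orbit[of y "4 / c"] by (meson not_le)
  qed
  then have "z \<in> interior filled_julia" using d(1) by (intro interiorI[of "ball z (d/2)"]) auto
  then show False using z by blast
qed

primrec piter :: "nat \<Rightarrow> complex poly" where
  "piter 0 = [:0, 1:]"
| "piter (Suc k) = pcompose p (piter k)"

lemma poly_piter: "poly (piter k) z = (poly p ^^ k) z"
  by (induction k) (simp_all add: poly_pcompose)

lemma degree_piter: "degree (piter k) = degree p ^ k"
  by (induction k) (simp_all add: degree_pcompose)

lemma lead_coeff_piter: "lead_coeff (piter k) = 1"
proof (induction k)
  case (Suc k)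
  have "degree (piter k) > 0" using deg by (simp add: degree_piter)
  then show ?case using Suc monic by (simp add: lead_coeff_comp)
qed simp

text \<open>The capacity of the Julia set is \<open>1\<close>: the filled Julia set is the decreasing intersection
  of the lemniscate domains of the monic iterates.\<close>

lemma lead_coeff_bound_julia:
  assumes f: "\<And>z. Cplx z \<in> julia_set (to_fract p) \<Longrightarrow> cmod (poly f z) \<le> M"
  shows "cmod (lead_coeff f) \<le> M"
proof -
  define L where "L k = {z. cmod (poly (piter k) z) \<le> R}" for k
  have closedL: "closed (L k)" for k
    unfolding L_def by (intro closed_Collect_le continuous_intros)
  have Lsub: "L (Suc k) \<subseteq> L k" for k
  proof
    fix z assume z: "z \<in> L (Suc k)"
    show "z \<in> L k"
    proof (rule ccontr)
      assume "z \<notin> L k"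
      then have *: "cmod ((poly p ^^ k) z) > R" by (simp add: L_def poly_piter)
      moreover have "cmod (poly p ((poly p ^^ k) z)) \<le> R"
        using z poly_piter[of "Suc k" z] by (simp add: L_def del: piter.simps)
      ultimately show False using escape[OF *] R by linarith
    qed
  qed
  have Lanti: "L j \<subseteq> L i" if "i \<le> j" for i j
    using that by (induction rule: dec_induct) (use Lsub in auto)
  have compactL: "compact (L k)" for k
  proof -
    have "L k \<subseteq> cball 0 R" using Lanti[of 0 k] by (auto simp: L_def)
    then show ?thesis using closedL by (meson bounded_cball bounded_subset compact_eq_bounded_closed)
  qed
  have K: "filled_julia = (\<Inter>k. L k)" by (auto simp: filled_julia_def L_def poly_piter)
  have closedK: "closed filled_julia" unfolding K using closedL by blast
  have boundedK: "bounded filled_julia"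
    using compactL[of 0] unfolding K by (meson INT_lower UNIV_I bounded_subset compact_imp_bounded)
  have fK: "cmod (poly f z) \<le> M" if "z \<in> filled_julia" for z
  proof (rule maximum_modulus_frontier[OF _ _ boundedK _ that])
    fix w assume "w \<in> frontier filled_julia"
    then show "cmod (poly f w) \<le> M"
      using closedK by (intro f frontier_filled_julia) (auto simp: frontier_def)
  qed (intro holomorphic_intros continuous_intros)+
  show ?thesis
  proof (rule field_le_epsilon)
    fix e :: real assume e: "e > 0"
    define G where "G k = L k \<inter> {z. M + e \<le> cmod (poly f z)}" for k
    have "\<exists>k. G k = {}"
    proof (rule ccontr)
      assume "\<nexists>k. G k = {}"
      then have "\<Inter>(range G) \<noteq> {}"
      proof (intro compact_nest)
        show "compact (G k)" for k
          unfolding G_def by (intro compact_Int_closed compactL closed_Collect_le continuous_intros)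
      qed (use Lanti in \<open>auto simp: G_def\<close>)
      then obtain z where z: "\<And>k. z \<in> G k" by blast
      then have "z \<in> filled_julia" unfolding K G_def by blast
      then show False using fK[of z] z[of 0] e by (simp add: G_def)
    qed
    then obtain k where k: "G k = {}" by blast
    show "cmod (lead_coeff f) \<le> M + e"
    proof (rule lead_coeff_bound_lemniscate[OF lead_coeff_piter])
      show "degree (piter k) > 0" using deg by (simp add: degree_piter)
      have "(poly p ^^ k) 0 = 0" by (induction k) (simp_all add: zero)
      then show "cmod (poly (piter k) 0) < R" using R by (simp add: poly_piter)
      fix z assume "cmod (poly (piter k) z) \<le> R"
      then have "\<not> M + e \<le> cmod (poly f z)" using k unfolding G_def L_def by blast
      then show "cmod (poly f z) \<le> M + e" by simp
    qed (rule R)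
  qed
qed

text \<open>The defect between \<open>p\<^sup>k \<circ> \<sigma>\<close> and \<open>p\<^sup>k\<close>, both normalised to the same leading term,
  for \<open>\<sigma> z = a z + b\<close>.\<close>

definition defect :: "complex \<Rightarrow> complex \<Rightarrow> nat \<Rightarrow> complex poly" where
  "defect a b k = pcompose (piter k) [:b, a:] - smult (a ^ degree p ^ k) (piter k)"

text \<open>Since \<open>p\<close> is centred, \<open>p Q - a ^ (N d) p P\<close> and \<open>Q ^ d - T ^ d\<close> with \<open>T = a ^ N P\<close> have the
  same leading term, and \<open>Q ^ d - T ^ d\<close> is the product of \<open>Q - T\<close> with a sum of \<open>d\<close> terms
  that share their leading term.\<close>

lemma lead_coeff_defect_Suc:
  assumes a: "cmod a = 1" and nz: "defect a b k \<noteq> 0"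
  shows "cmod (lead_coeff (defect a b (Suc k))) = real (degree p) * cmod (lead_coeff (defect a b k))"
proof -
  define d N where "d = degree p" and "N = degree p ^ k"
  define P Q T where "P = piter k" and "Q = pcompose (piter k) [:b, a:]" and "T = smult (a ^ N) P"
  have a0: "a \<noteq> 0" using a by auto
  have d: "d \<ge> 2" using deg by (simp add: d_def)
  have N: "N > 0" using deg by (simp add: N_def)
  have P: "degree P = N" "lead_coeff P = 1" using lead_coeff_piter[of k] by (simp_all add: P_def N_def degree_piter)
  have T: "degree T = N" "lead_coeff T = a ^ N" using P a0 by (simp_all add: T_def)
  have Q: "degree Q = N" "lead_coeff Q = a ^ N"
    using a0 P lead_coeff_comp[of "[:b, a:]" "piter k"]
    by (simp_all add: Q_def P_def degree_pcompose)
  have QT: "defect a b k = Q - T" by (simp add: defect_def Q_def T_def P_def N_def)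
  define g where "g = p - monom 1 d"
  have g: "degree g \<le> d - 2"
  proof (rule degree_le, intro allI impI)
    fix i assume "i > d - 2"
    then consider "i = d - 1" | "i = d" | "i > d" by linarith
    then show "coeff g i = 0"
      using d centred monic by cases (auto simp: g_def d_def coeff_eq_0)
  qed
  define S where "S = (\<Sum>i<d. T ^ (d - Suc i) * Q ^ i)"
  have "poly (Q ^ d - T ^ d) z = poly ((Q - T) * S) z" for z
    using power_diff_sumr2[of "poly Q z" d "poly T z"] by (simp add: S_def poly_sum)
  then have fac: "Q ^ d - T ^ d = (Q - T) * S" by (intro poly_ext)
  have terms: "degree (T ^ (d - Suc i) * Q ^ i) = N * (d - 1)"
      "lead_coeff (T ^ (d - Suc i) * Q ^ i) = a ^ (N * (d - 1))" if "i < d" for i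
  proof -
    have TQ0: "T \<noteq> 0" "Q \<noteq> 0" using T Q N by auto
    have sm: "d - Suc i + i = d - 1" using that by simp
    show "degree (T ^ (d - Suc i) * Q ^ i) = N * (d - 1)"
      using TQ0 T(1) Q(1) sm by (simp add: degree_mult_eq degree_power_eq flip: distrib_right)
    show "lead_coeff (T ^ (d - Suc i) * Q ^ i) = a ^ (N * (d - 1))"
      unfolding lead_coeff_mult lead_coeff_power T(2) Q(2) sm[symmetric]
      by (simp add: power_add power_mult distrib_left)
  qed
  have "degree S \<le> N * (d - 1)"
    unfolding S_def by (intro degree_sum_le) (use terms in auto)
  moreover have cS: "coeff S (N * (d - 1)) = of_nat d * a ^ (N * (d - 1))"
  proof -
    have "coeff S (N * (d - 1)) = (\<Sum>i<d. a ^ (N * (d - 1)))"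
      unfolding S_def coeff_sum by (rule sum.cong) (use terms in auto)
    then show ?thesis by simp
  qed
  moreover have "coeff S (N * (d - 1)) \<noteq> 0" using cS a0 d by simp
  ultimately have S: "degree S = N * (d - 1)" "lead_coeff S = of_nat d * a ^ (N * (d - 1))"
    using le_degree[of S "N * (d - 1)"] by (simp_all add: antisym)
  define A B where "A = (Q - T) * S" and "B = pcompose g Q - smult (a ^ (N * d)) (pcompose g P)"
  have "defect a b (Suc k) = A + B"
  proof (rule poly_ext)
    fix z
    have p: "poly p w = w ^ d + poly g w" for w by (simp add: g_def poly_monom)
    have "poly (defect a b (Suc k)) z = poly p (poly Q z) - a ^ (N * d) * poly p (poly P z)"
      by (simp add: defect_def poly_pcompose Q_def P_def N_def d_def mult.commute)
    also have "\<dots> = poly (Q ^ d - T ^ d + B) z"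
      unfolding p by (simp add: B_def poly_pcompose T_def power_mult_distrib power_mult algebra_simps)
    finally show "poly (defect a b (Suc k)) z = poly (A + B) z" by (simp only: fac A_def)
  qed
  moreover have "lead_coeff (A + B) = lead_coeff A"
  proof -
    have "degree (pcompose g Q) \<le> (d - 2) * N" "degree (pcompose g P) \<le> (d - 2) * N"
      using g P(1) Q(1) by (simp_all add: degree_pcompose)
    then have "degree B \<le> (d - 2) * N"
      unfolding B_def by (intro degree_diff_le order.trans[OF degree_smult_le])
    also have "(d - 2) * N < (d - 1) * N" using d N by (intro mult_strict_right_mono) auto
    also have "(d - 1) * N \<le> degree A"
    proof -
      have "Q - T \<noteq> 0" "S \<noteq> 0" using nz QT S(2) a0 d by auto
      then show ?thesis by (simp add: A_def degree_mult_eq S(1) mult.commute)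
    qed
    finally show ?thesis by (metis add.commute lead_coeff_add_le)
  qed
  ultimately have "lead_coeff (defect a b (Suc k)) = lead_coeff (defect a b k) * (of_nat d * a ^ (N * (d - 1)))"
    by (simp only: A_def lead_coeff_mult S(2) QT)
  then show ?thesis using a by (simp add: norm_mult norm_power d_def)
qed

text \<open>A nonzero defect would have leading coefficients that grow like \<open>d ^ k\<close>, while the defects are uniformly
  bounded on the Julia set.\<close>

theorem symmetry_equivariant:
  assumes s: "(\<lambda>z. a * z + b) \<in> symmetry_group (to_fract p)" and a: "cmod a = 1"
  shows "b = 0" and "poly p (a * z) = a ^ degree p * poly p z"
proof -
  have bd: "cmod (lead_coeff (defect a b k)) \<le> 2 * R" for k
  proof (rule lead_coeff_bound_julia)
    fix z assume z: "Cplx z \<in> julia_set (to_fract p)"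
    then have "Cplx (a * z + b) \<in> julia_set (to_fract p)"
      using symmetry_group_julia_iff[OF s] by simp
    then have "cmod ((poly p ^^ k) (a * z + b)) \<le> R" "cmod ((poly p ^^ k) z) \<le> R"
      using z julia_subset_filled_julia by (auto simp: filled_julia_def)
    moreover have "poly (defect a b k) z = (poly p ^^ k) (a * z + b) - a ^ degree p ^ k * (poly p ^^ k) z"
      by (simp add: defect_def poly_pcompose poly_piter algebra_simps)
    moreover have "cmod (a ^ degree p ^ k * (poly p ^^ k) z) = cmod ((poly p ^^ k) z)"
      using a by (simp add: norm_mult norm_power)
    ultimately show "cmod (poly (defect a b k) z) \<le> 2 * R"
      using norm_triangle_ineq4[of "(poly p ^^ k) (a * z + b)" "a ^ degree p ^ k * (poly p ^^ k) z"] by simp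
  qed
  have vanish: "defect a b k = 0" for k
  proof (rule ccontr)
    assume nz: "defect a b k \<noteq> 0"
    have grow: "defect a b (k + j) \<noteq> 0 \<and>
        cmod (lead_coeff (defect a b (k + j))) = real (degree p) ^ j * cmod (lead_coeff (defect a b k))" for j
    proof (induction j)
      case (Suc j)
      then have "cmod (lead_coeff (defect a b (Suc (k + j))))
          = real (degree p) * (real (degree p) ^ j * cmod (lead_coeff (defect a b k)))"
        using lead_coeff_defect_Suc[OF a, of b "k + j"] by simp
      moreover from this have "defect a b (Suc (k + j)) \<noteq> 0" using nz deg by auto
      ultimately show ?case by simp
    qed (use nz in simp)
    define c where "c = cmod (lead_coeff (defect a b k))"
    have c: "c > 0" using nz by (simp add: c_def)
    have "1 < real (degree p)" using deg by simp
    then obtain j where "2 * R / c < real (degree p) ^ j" using real_arch_pow by blast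
    then have "2 * R < real (degree p) ^ j * c" using c by (simp add: pos_divide_less_eq)
    then show False using grow[of j] bd[of "k + j"] by (simp add: c_def)
  qed
  have "poly (defect a b 0) 0 = 0" using vanish[of 0] by simp
  then show b: "b = 0" by (simp add: defect_def poly_pcompose)
  have "poly (defect a b 1) z = 0" using vanish[of 1] by simp
  then show "poly p (a * z) = a ^ degree p * poly p z"
    using b by (simp add: defect_def poly_pcompose mult.commute)
qed

end

section \<open>Chebyshev's method for z (z^n - 1)\<close>

declare sphere_map.simps [simp del]

text \<open>In terms of \<open>v = z ^ n\<close> one step of the method multiplies \<open>z\<close> by a rational function of
  \<open>v\<close>, which is written here over an arbitrary field to be used over the reals as well.\<close>

definition cheb_factor :: "nat \<Rightarrow> 'a::field \<Rightarrow> 'a" where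
  "cheb_factor n v = v * (of_nat n * (of_nat n + 1) * (2 * of_nat n + 1) * v\<^sup>2
      - 2 * of_nat n * (of_nat n + 1) * v - of_nat n * (of_nat n - 1)) / (2 * ((of_nat n + 1) * v - 1) ^ 3)"

definition cheb :: "nat \<Rightarrow> 'a::field \<Rightarrow> 'a" where
  "cheb n z = z * cheb_factor n (z ^ n)"

definition cheb_deriv :: "nat \<Rightarrow> 'a::field \<Rightarrow> 'a" where
  "cheb_deriv n v = (v - 1)\<^sup>2 * of_nat n * (of_nat n + 1) * v *
      (3 * of_nat n * (of_nat n + 1) * v - (of_nat n - 1) * ((of_nat n + 1) * v - 1))
      / (2 * ((of_nat n + 1) * v - 1) ^ 4)"

text \<open>The derivative vanishes to second order at the roots of unity and factors as
  \<open>L\<^sup>2 (3 - L')/2\<close>, where \<open>L = p p'' / p'\<^sup>2\<close> and \<open>L' = p' p''' / p''\<^sup>2\<close>.\<close>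

lemma has_field_derivative_cheb:
  fixes z :: "'a::real_normed_field"
  assumes n: "n > 0" and D0: "(of_nat n + 1) * z ^ n - 1 \<noteq> 0"
  shows "(cheb n has_field_derivative cheb_deriv n (z ^ n)) (at z)"
proof -
  define N v where "N = (of_nat n :: 'a)" and "v = z ^ n"
  define D A A' where "D = (N + 1) * v - 1"
    and "A = v * (N * (N + 1) * (2 * N + 1) * v\<^sup>2 - 2 * N * (N + 1) * v - N * (N - 1))"
    and "A' = 3 * N * (N + 1) * (2 * N + 1) * v\<^sup>2 - 2 * (2 * N * (N + 1)) * v - N * (N - 1)"
  have D: "D \<noteq> 0" using D0 by (simp add: D_def N_def v_def)
  have f: "cheb_factor n v = A / (2 * D ^ 3)" by (simp add: cheb_factor_def A_def D_def N_def)
  have dA: "((\<lambda>x. x * (N * (N + 1) * (2 * N + 1) * x\<^sup>2 - 2 * N * (N + 1) * x - N * (N - 1)))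
      has_field_derivative A') (at v)"
    unfolding A'_def by (rule derivative_eq_intros refl | simp add: algebra_simps power2_eq_square)+
  have dD: "((\<lambda>x. 2 * ((N + 1) * x - 1) ^ 3) has_field_derivative 6 * (N + 1) * D\<^sup>2) (at v)"
    unfolding D_def by (rule derivative_eq_intros refl | simp)+
  have "(cheb_factor n has_field_derivative (A' * (2 * D ^ 3) - A * (6 * (N + 1) * D\<^sup>2)) / (2 * D ^ 3)\<^sup>2) (at v)"
  proof -
    have "((\<lambda>x. x * (N * (N + 1) * (2 * N + 1) * x\<^sup>2 - 2 * N * (N + 1) * x - N * (N - 1)) / (2 * ((N + 1) * x - 1) ^ 3))
      has_field_derivative (A' * (2 * D ^ 3) - A * (6 * (N + 1) * D\<^sup>2)) / ((2 * D ^ 3) * (2 * D ^ 3))) (at v)"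
      using DERIV_divide[OF dA dD] D unfolding D_def[symmetric] A_def[symmetric] by simp
    then show ?thesis by (simp add: cheb_factor_def[abs_def] N_def power2_eq_square)
  qed
  also have "(A' * (2 * D ^ 3) - A * (6 * (N + 1) * D\<^sup>2)) / (2 * D ^ 3)\<^sup>2 = (A' * D - 3 * (N + 1) * A) / (2 * D ^ 4)"
  proof -
    have e1: "A' * (2 * D ^ 3) - A * (6 * (N + 1) * D\<^sup>2) = (A' * D - 3 * (N + 1) * A) * (2 * D\<^sup>2)"
      by (simp add: algebra_simps power2_eq_square power3_eq_cube)
    have e2: "(2 * D ^ 3)\<^sup>2 = (2 * D ^ 4) * (2 * D\<^sup>2)"
      by (simp add: power2_eq_square power3_eq_cube power4_eq_xxxx)
    show ?thesis
      unfolding e1 e2 by (rule nonzero_mult_divide_mult_cancel_right) (use D in simp)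
  qed
  finally have df: "(cheb_factor n has_field_derivative (A' * D - 3 * (N + 1) * A) / (2 * D ^ 4)) (at (z ^ n))"
    by (simp add: v_def)
  have "((\<lambda>x. x ^ n) has_field_derivative N * z ^ (n - 1)) (at z)"
    unfolding N_def by (rule derivative_eq_intros refl | simp)+
  from DERIV_mult[OF DERIV_ident DERIV_chain2[OF df this]]
  have "(cheb n has_field_derivative
      1 * cheb_factor n (z ^ n) + (A' * D - 3 * (N + 1) * A) / (2 * D ^ 4) * (N * z ^ (n - 1)) * z) (at z)"
    by (simp add: cheb_def[abs_def])
  also have "1 * cheb_factor n (z ^ n) + (A' * D - 3 * (N + 1) * A) / (2 * D ^ 4) * (N * z ^ (n - 1)) * z
      = A / (2 * D ^ 3) + N * v * ((A' * D - 3 * (N + 1) * A) / (2 * D ^ 4))"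
  proof -
    have "z ^ (n - 1) * z = v" using n by (cases n) (simp_all add: v_def mult.commute)
    then show ?thesis using f by (simp add: v_def mult_ac)
  qed
  also have "A / (2 * D ^ 3) = A * D / (2 * D ^ 4)"
    using D by (simp add: power3_eq_cube power4_eq_xxxx)
  also have "A * D / (2 * D ^ 4) + N * v * ((A' * D - 3 * (N + 1) * A) / (2 * D ^ 4))
      = (A * D + N * v * (A' * D - 3 * (N + 1) * A)) / (2 * D ^ 4)"
    by (simp add: add_divide_distrib)
  also have "A * D + N * v * (A' * D - 3 * (N + 1) * A)
      = (v - 1)\<^sup>2 * N * (N + 1) * v * (3 * N * (N + 1) * v - (N - 1) * D)"
    unfolding A_def A'_def D_def by (simp add: algebra_simps power2_eq_square)
  finally show ?thesis by (simp add: cheb_deriv_def N_def v_def D_def)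
qed

lemma cheb_of_real: "cheb n (of_real x) = (of_real (cheb n x) :: complex)"
  by (simp add: cheb_def cheb_factor_def)

lemma cheb_rotate: "l ^ n = 1 \<Longrightarrow> cheb n (l * z) = l * cheb n z"
  by (simp add: cheb_def power_mult_distrib)

lemma cheb_one: "cheb n (1 :: 'a::{field_char_0}) = 1" if "n > 0"
proof -
  have "2 * (of_nat n :: 'a) ^ 3 \<noteq> 0" using that by simp
  moreover have "N * (N + 1) * (2 * N + 1) - 2 * N * (N + 1) - N * (N - 1) = 2 * N ^ 3" for N :: 'a
    by (simp add: algebra_simps power3_eq_cube)
  ultimately show ?thesis by (simp add: cheb_def cheb_factor_def)
qed

lemma cheb_zero: "cheb n 0 = 0"
  by (simp add: cheb_def)

subsection \<open>Real dynamics\<close>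

text \<open>On \<open>[1, \<infinity>)\<close> the polynomial, its derivative and its second derivative are nonnegative, so each step
  moves to the left; it does not pass \<open>1\<close>, since the method is monotone there.\<close>

lemma cheb_denominator_pos:
  fixes x :: real
  assumes n: "n > 1" and x: "x \<ge> 1"
  shows "(of_nat n + 1) * x ^ n - 1 > 0"
proof -
  have "1 < (real n + 1) * 1" using n by simp
  also have "\<dots> \<le> (real n + 1) * x ^ n"
    using x by (intro mult_left_mono one_le_power) auto
  finally show ?thesis by simp
qed

lemma cheb_ge_one:
  fixes x :: real
  assumes n: "n > 1" and x: "x \<ge> 1"
  shows "cheb n x \<ge> 1"
proof -
  have "cheb n 1 \<le> cheb n x"
  proof (rule DERIV_nonneg_imp_nondecreasing[OF x])
    fix y :: real assume y: "1 \<le> y" "y \<le> x"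
    define N v D where "N = real n" and "v = y ^ n" and "D = (N + 1) * v - 1"
    have v: "v \<ge> 1" using y by (simp add: v_def one_le_power)
    have N: "N \<ge> 1" using n by (simp add: N_def)
    have D: "D > 0"
      unfolding D_def N_def v_def using y(1) by (rule cheb_denominator_pos[OF n])
    have "(N - 1) * D \<le> (N - 1) * ((N + 1) * v)" using N by (intro mult_left_mono) (auto simp: D_def)
    also have "\<dots> \<le> 3 * N * ((N + 1) * v)" using N v by (intro mult_right_mono) auto
    finally have "3 * N * (N + 1) * v - (N - 1) * D \<ge> 0" by (simp add: mult.assoc)
    then have "cheb_deriv n v \<ge> 0"
      using v N D unfolding cheb_deriv_def N_def[symmetric] D_def[symmetric]
      by (intro divide_nonneg_nonneg mult_nonneg_nonneg) auto
    moreover have "(cheb n has_real_derivative cheb_deriv n v) (at y)"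
      unfolding v_def using n D by (intro has_field_derivative_cheb) (auto simp: D_def v_def N_def)
    ultimately show "\<exists>d. (cheb n has_real_derivative d) (at y) \<and> d \<ge> 0" by blast
  qed
  then show ?thesis using cheb_one[of n, where 'a = real] n by simp
qed

lemma cheb_less:
  fixes x :: real
  assumes n: "n > 1" and x1: "x > 1"
  shows "cheb n x < x"
proof -
  define N v D where "N = real n" and "v = x ^ n" and "D = (N + 1) * v - 1"
  have v: "v > 1" using x1 n by (simp add: v_def one_less_power)
  have N: "N \<ge> 1" using n by (simp add: N_def)
  have D: "D > 0" using cheb_denominator_pos[OF n, of x] x1 by (simp add: D_def N_def v_def)
  have "2 * D ^ 3 - v * (N * (N + 1) * (2 * N + 1) * v\<^sup>2 - 2 * N * (N + 1) * v - N * (N - 1))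
      = (v - 1) * (2 * D\<^sup>2 + N * (N + 1) * v * (v - 1))"
    unfolding D_def by (simp add: algebra_simps power2_eq_square power3_eq_cube)
  also have "\<dots> > 0" using v N D by (intro mult_pos_pos add_pos_nonneg mult_nonneg_nonneg) auto
  finally have "cheb_factor n v < 1"
    using D by (simp add: cheb_factor_def flip: N_def D_def)
  then have "x * cheb_factor n v < x * 1" using x1 by (intro mult_strict_left_mono) auto
  then show ?thesis by (simp add: cheb_def v_def)
qed

lemma cheb_iterate_ge_one:
  fixes x :: real
  assumes n: "n > 1" and x: "x \<ge> 1"
  shows "(cheb n ^^ k) x \<ge> 1"
proof (induction k)
  case (Suc k)
  show ?case using cheb_ge_one[OF n Suc.IH] by simp
qed (use x in simp)

lemma cheb_iterate_tendsto:
  fixes x :: real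
  assumes n: "n > 1" and x: "x \<ge> 1"
  shows "(\<lambda>k. (cheb n ^^ k) x) \<longlonglongrightarrow> 1"
proof -
  have le: "cheb n y \<le> y" if "y \<ge> 1" for y :: real
    using that cheb_less[OF n, of y] cheb_one[of n, where 'a = real] n by (cases "y = 1") auto
  have "decseq (\<lambda>k. (cheb n ^^ k) x)"
    using le cheb_iterate_ge_one[OF n x] by (intro decseq_SucI) simp
  then obtain l where l: "(\<lambda>k. (cheb n ^^ k) x) \<longlonglongrightarrow> l"
    using decseq_convergent[of "\<lambda>k. (cheb n ^^ k) x" 1] cheb_iterate_ge_one[OF n x] by blast
  have l1: "l \<ge> 1" by (rule LIMSEQ_le_const[OF l]) (use cheb_iterate_ge_one[OF n x] in blast)
  have "isCont (cheb n) l"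
    using cheb_denominator_pos[OF n l1] n
    by (intro DERIV_isCont[OF has_field_derivative_cheb]) auto
  then have "(\<lambda>k. cheb n ((cheb n ^^ k) x)) \<longlonglongrightarrow> cheb n l" using l by (rule isCont_tendsto_compose)
  moreover have "(\<lambda>k. cheb n ((cheb n ^^ k) x)) \<longlonglongrightarrow> l" using LIMSEQ_Suc[OF l] by simp
  ultimately have "cheb n l = l" by (rule LIMSEQ_unique)
  then have "l = 1" using cheb_less[OF n, of l] l1 by (cases "l = 1") auto
  then show ?thesis using l by simp
qed

subsection \<open>The method as a map of the sphere\<close>

lemma coprime_poly_no_common_root:
  fixes a b :: "complex poly"
  assumes "b \<noteq> 0" "\<And>z. poly a z = 0 \<Longrightarrow> poly b z \<noteq> 0"
  shows "coprime a b"
proof (rule coprimeI)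
  fix c assume c: "c dvd a" "c dvd b"
  have c0: "c \<noteq> 0" using c(2) assms(1) by auto
  have "degree c = 0"
  proof (rule ccontr)
    assume "degree c \<noteq> 0"
    then obtain z where "poly c z = 0"
      using Fundamental_Theorem_Algebra.fundamental_theorem_of_algebra by (auto simp: constant_degree)
    then have "poly a z = 0" "poly b z = 0" using c by (metis dvd_trans poly_eq_0_iff_dvd)+
    then show False using assms(2) by blast
  qed
  then show "is_unit c" using c0 is_unit_iff_degree by blast
qed

locale chebyshev_method =
  fixes n :: nat
  assumes n: "n > 1"
begin

text \<open>The poles of the method are the zeros of the derivative of the polynomial.\<close>

definition regular :: "complex set" where
  "regular = {z. (of_nat n + 1) * z ^ n \<noteq> 1}"

text \<open>Numerator and denominator are coprime: at a pole, where \<open>(N + 1) z ^ n = 1\<close> with \<open>N = n\<close>, the numerator is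
  a nonzero multiple of \<open>N ^ 3\<close>.\<close>

lemma sphere_map_cheb:
  shows "sphere_map (chebyshev (p_poly n)) (Cplx z) = (if z \<in> regular then Cplx (cheb n z) else Infty)"
    and "sphere_map (chebyshev (p_poly n)) Infty = Infty"
proof -
  define A where "A = [:0, 1::complex:] ^ (n + 1) * (of_nat (n * (n + 1) * (2 * n + 1)) * [:0, 1:] ^ (2 * n)
      - of_nat (2 * n * (n + 1)) * [:0, 1:] ^ n - of_nat (n * (n - 1)))"
  define B where "B = 2 * (of_nat (n + 1) * [:0, 1::complex:] ^ n - 1) ^ 3"
  have ch: "chebyshev (p_poly n) = Fract A B"
    using chebyshev_p_poly[of n] n unfolding A_def B_def by simp
  define N where "N = (of_nat n :: complex)"
  have pA: "poly A z = z * (z ^ n * (N * (N + 1) * (2 * N + 1) * (z ^ n)\<^sup>2 - 2 * N * (N + 1) * z ^ n - N * (N - 1)))" for z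
    using n by (simp add: A_def N_def of_nat_diff algebra_simps power_mult flip: power_mult)
  have pB: "poly B z = 2 * ((N + 1) * z ^ n - 1) ^ 3" for z
    by (simp add: B_def N_def algebra_simps)
  have "poly B 0 \<noteq> 0" using n by (simp add: pB power_0_left)
  then have B0: "B \<noteq> 0" by auto
  have N0: "N \<noteq> 0" using n by (simp add: N_def)
  have cop: "coprime A B"
  proof (rule coprime_poly_no_common_root[OF B0])
    fix z assume A: "poly A z = 0"
    show "poly B z \<noteq> 0"
    proof
      assume "poly B z = 0"
      then have v: "(N + 1) * z ^ n = 1" by (simp add: pB)
      then have z0: "z \<noteq> 0" using n by (auto simp: power_0_left)
      have "N * (N + 1) * (2 * N + 1) * (z ^ n)\<^sup>2 - 2 * N * (N + 1) * z ^ n - N * (N - 1) = 0"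
        using A z0 by (simp add: pA)
      then have "(N + 1) * (N * (N + 1) * (2 * N + 1) * (z ^ n)\<^sup>2 - 2 * N * (N + 1) * z ^ n - N * (N - 1)) = 0"
        by simp
      also have "(N + 1) * (N * (N + 1) * (2 * N + 1) * (z ^ n)\<^sup>2 - 2 * N * (N + 1) * z ^ n - N * (N - 1))
          = N * (2 * N + 1) * ((N + 1) * z ^ n)\<^sup>2 - 2 * N * (N + 1) * ((N + 1) * z ^ n) - (N + 1) * N * (N - 1)"
        by (simp add: algebra_simps power2_eq_square)
      also have "\<dots> = - (N ^ 3)" unfolding v by (simp add: algebra_simps power3_eq_cube)
      finally show False using N0 by simp
    qed
  qed
  have reg: "poly B z = 0 \<longleftrightarrow> z \<notin> regular" for z by (simp add: pB regular_def N_def)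
  show "sphere_map (chebyshev (p_poly n)) (Cplx z) = (if z \<in> regular then Cplx (cheb n z) else Infty)"
    unfolding ch sphere_map_Fract(1)[OF cop B0] reg
    by (simp add: pA pB cheb_def cheb_factor_def N_def)
  have "degree B \<le> 3 * n"
  proof -
    have "degree (of_nat (n + 1) * [:0, 1::complex:] ^ n - 1) \<le> n"
      by (intro degree_diff_le order.trans[OF degree_mult_le]) (simp_all add: degree_power_eq del: of_nat_add of_nat_Suc)
    then have "degree ((of_nat (n + 1) * [:0, 1::complex:] ^ n - 1) ^ 3) \<le> n * 3"
      by (intro order.trans[OF degree_power_le] mult_right_mono) auto
    then have "degree B \<le> 0 + n * 3"
      unfolding B_def by (intro order.trans[OF degree_mult_le] add_mono) auto
    then show ?thesis by simp
  qed
  moreover have "3 * n + 1 \<le> degree A"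
  proof (rule le_degree)
    have X: "[:0, 1::complex:] ^ k = monom 1 k" for k by (simp add: monom_altdef)
    have "coeff A (3 * n + 1) = of_nat (n * (n + 1) * (2 * n + 1))"
      using n unfolding A_def X of_nat_poly coeff_monom_mult by (simp add: coeff_eq_0)
    also have "\<dots> \<noteq> 0" using n by (simp del: of_nat_mult of_nat_add)
    finally show "coeff A (3 * n + 1) \<noteq> 0" .
  qed
  ultimately show "sphere_map (chebyshev (p_poly n)) Infty = Infty"
    unfolding ch sphere_map_Fract(2)[OF cop B0] by simp
qed

abbreviation "CF \<equiv> fatou_set (chebyshev (p_poly n))"
abbreviation "CJ \<equiv> julia_set (chebyshev (p_poly n))"
abbreviation "Cf \<equiv> sphere_map (chebyshev (p_poly n))"

lemma finite_irregular: "finite (- regular)"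
proof -
  have "- regular = {z. poly (smult (of_nat n + 1) (monom 1 n) - 1) z = 0}"
    by (auto simp: regular_def poly_monom)
  moreover have "smult (of_nat n + 1) (monom 1 n) - 1 \<noteq> (0 :: complex poly)"
  proof
    assume "smult (of_nat n + 1) (monom 1 n) - 1 = (0 :: complex poly)"
    then have "poly (smult (of_nat n + 1) (monom 1 n) - 1) (0::complex) = 0" by simp
    then show False using n by (simp add: poly_monom power_0_left)
  qed
  ultimately show ?thesis using poly_roots_finite by metis
qed

lemma open_regular: "open regular"
  using finite_imp_closed[OF finite_irregular] by (simp add: closed_def)

lemma connected_regular: "connected regular"
  using connected_open_delete_finite[of UNIV "- regular"] finite_irregular
  by (simp add: Diff_eq connected_UNIV)

lemma root_of_unity_regular: "l ^ n = 1 \<Longrightarrow> l \<in> regular"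
  using n by (simp add: regular_def)

lemma zero_regular: "0 \<in> regular"
  using n by (simp add: regular_def power_0_left)

lemma far_regular: "cmod z \<ge> 1 \<Longrightarrow> z \<in> regular"
proof -
  assume z: "cmod z \<ge> 1"
  have "1 * 1 < (real n + 1) * cmod z ^ n"
    using z n one_le_power[OF z, of n] by (intro mult_less_le_imp_less) auto
  also have "\<dots> = cmod ((of_nat n + 1) * z ^ n)"
    by (simp add: norm_mult norm_power flip: of_nat_Suc add: add.commute)
  finally have "cmod ((of_nat n + 1) * z ^ n) \<noteq> 1" by simp
  then show "z \<in> regular" unfolding regular_def by (metis (mono_tags, lifting) mem_Collect_eq norm_one)
qed

lemma holomorphic_cheb: "cheb n holomorphic_on regular"
proof -
  have "(cheb n has_field_derivative cheb_deriv n (z ^ n)) (at z within regular)" if "z \<in> regular" for z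
    using that n by (intro has_field_derivative_at_within[OF has_field_derivative_cheb]) (auto simp: regular_def)
  then show ?thesis by (auto simp: holomorphic_on_def field_differentiable_def)
qed

lemma continuous_on_Cf: "continuous_on (Cplx ` regular) Cf"
proof -
  have "continuous_on (Cplx ` regular) (\<lambda>x. Cplx (cheb n (affine_part x)))"
    by (intro continuous_on_compose2[OF continuous_on_Cplx[of UNIV]]
        continuous_on_compose2[OF holomorphic_on_imp_continuous_on[OF holomorphic_cheb]]
        continuous_on_subset[OF continuous_on_affine_part]) auto
  then show ?thesis by (rule continuous_on_eq) (auto simp: sphere_map_cheb)
qed

lemma open_map_Cf:
  assumes "open U" "U \<subseteq> Cplx ` regular"
  shows "open (Cf ` U)"
proof -
  let ?V = "Cplx -` U"
  have V: "open ?V" "?V \<subseteq> regular" using assms open_Cplx_vimage by auto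
  have "Cf ` U = Cplx ` (cheb n ` ?V)"
  proof -
    have "U = Cplx ` ?V" using assms(2) by auto
    then have "Cf ` U = Cf ` Cplx ` ?V" by simp
    also have "\<dots> = Cplx ` (cheb n ` ?V)"
      unfolding image_image by (rule image_cong) (use V(2) in \<open>auto simp: sphere_map_cheb\<close>)
    finally show ?thesis .
  qed
  moreover have "\<not> cheb n constant_on regular"
  proof
    assume "cheb n constant_on regular"
    then have "cheb n (0::complex) = cheb n 1"
      using zero_regular root_of_unity_regular[of 1] unfolding constant_on_def by auto
    then show False using n by (simp add: cheb_one cheb_zero)
  qed
  then have "open (cheb n ` ?V)"
    using open_mapping_thm[OF holomorphic_cheb open_regular connected_regular V] by blast
  ultimately show ?thesis using open_Cplx_image by simp
qed

text \<open>Away from the poles the method is continuous and open, so that the Fatou set can be both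
  pulled back and pushed forward.\<close>

lemma fatou_cheb_iff:
  assumes z: "z \<in> regular"
  shows "Cplx (cheb n z) \<in> CF \<longleftrightarrow> Cplx z \<in> CF"
proof -
  have V: "open (Cplx ` regular)" "Cplx z \<in> Cplx ` regular"
    using z open_Cplx_image[OF open_regular] by auto
  have f: "Cf (Cplx z) = Cplx (cheb n z)" using z by (simp add: sphere_map_cheb)
  show ?thesis
    using fatou_set_preimage[OF V continuous_on_Cf] fatou_set_image[OF V open_map_Cf] f by auto
qed

text \<open>Since the derivative vanishes at \<open>c\<close>, each step at least halves the distance to \<open>c\<close> nearby.\<close>

lemma critical_fixed_point_basin:
  assumes c: "c \<in> regular" "cheb n c = c" "cheb_deriv n (c ^ n) = 0"
  shows "\<exists>U. open U \<and> Cplx c \<in> U \<and> U \<subseteq> CF \<and> (\<forall>x\<in>U. (\<lambda>m. (Cf ^^ m) x) \<longlonglongrightarrow> Cplx c)"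
proof -
  have "(cheb n has_field_derivative 0) (at c)"
    using has_field_derivative_cheb[of n c] c n by (auto simp: regular_def)
  then have "((\<lambda>z. (cheb n z - cheb n c) / (z - c)) \<longlongrightarrow> 0) (at c)"
    by (simp add: has_field_derivative_iff)
  then have "\<forall>\<^sub>F z in at c. dist ((cheb n z - cheb n c) / (z - c)) 0 < 1 / 2"
    by (rule tendstoD) simp
  then obtain d where d: "d > 0" "\<And>z. z \<noteq> c \<Longrightarrow> dist z c < d \<Longrightarrow> cmod ((cheb n z - c) / (z - c)) < 1 / 2"
    unfolding eventually_at using c(2) by (auto simp: dist_norm)
  obtain d' where d': "d' > 0" "ball c d' \<subseteq> regular"
    using open_regular c(1) open_contains_ball by blast
  define r where "r = min 1 (min d d')"
  have r: "r > 0" "r \<le> 1" "ball c r \<subseteq> regular" using d d' by (auto simp: r_def)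
  have half: "cmod (cheb n z - c) \<le> cmod (z - c) / 2" if "z \<in> ball c r" for z
  proof (cases "z = c")
    case False
    then have "cmod ((cheb n z - c) / (z - c)) < 1 / 2"
      using that by (intro d(2)) (auto simp: r_def dist_commute)
    then show ?thesis using False by (simp add: norm_divide pos_divide_less_eq)
  qed (use c in simp)
  have iter: "(Cf ^^ m) (Cplx z) \<in> Cplx ` cball c (cmod (z - c) / 2 ^ m)" if "z \<in> ball c r" for m z
  proof (induction m)
    case (Suc m)
    then obtain w where w: "(Cf ^^ m) (Cplx z) = Cplx w" "cmod (w - c) \<le> cmod (z - c) / 2 ^ m"
      by (auto simp: dist_norm norm_minus_commute)
    have "cmod (z - c) / 2 ^ m \<le> cmod (z - c) / 1" by (intro divide_left_mono) auto
    then have wr: "w \<in> ball c r" using w(2) that by (simp add: dist_norm norm_minus_commute)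
    then have "Cf (Cplx w) = Cplx (cheb n w)" using r(3) by (auto simp: sphere_map_cheb)
    moreover have "cmod (cheb n w - c) \<le> cmod (z - c) / 2 ^ Suc m" using half[OF wr] w(2) by simp
    ultimately show ?case using w(1) by (auto simp: dist_norm norm_minus_commute)
  qed (auto simp: dist_norm norm_minus_commute)
  let ?U = "Cplx ` ball c r"
  have U: "open ?U" by (rule open_Cplx_image) simp
  have unif: "\<exists>k. \<forall>m\<ge>k. \<forall>y\<in>?U. dist ((Cf ^^ m) y) (Cplx c) < e" if e: "e > 0" for e
  proof -
    obtain k where k: "2 / e < 2 ^ k" using real_arch_pow[of 2 "2 / e"] by auto
    show ?thesis
    proof (intro exI[of _ k] allI impI ballI)
      fix m y assume m: "m \<ge> k" and "y \<in> ?U"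
      then obtain z where z: "y = Cplx z" "z \<in> ball c r" by blast
      obtain w where w: "(Cf ^^ m) y = Cplx w" "cmod (w - c) \<le> cmod (z - c) / 2 ^ m"
        using iter[OF z(2), of m] z(1) by (auto simp: dist_norm norm_minus_commute)
      have "cmod (z - c) / 2 ^ m \<le> 1 / 2 ^ k"
        using z(2) r(2) m by (intro frac_le power_increasing) (auto simp: dist_norm norm_minus_commute)
      moreover have "1 / 2 ^ k < e / 2" using k e by (simp add: pos_divide_less_eq mult.commute)
      ultimately have "2 * cmod (w - c) < e" using w(2) by linarith
      then show "dist ((Cf ^^ m) y) (Cplx c) < e" using dist_Cplx_le[of w c] w(1) by simp
    qed
  qed
  show ?thesis
  proof (intro exI[of _ ?U] conjI ballI subsetI U)
    fix x assume x: "x \<in> ?U"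
    show "x \<in> CF"
    proof (rule fatou_set_uniform_basin[OF U x _ _ unif])
      show "Cf ` ?U \<subseteq> ?U"
      proof
        fix y assume "y \<in> Cf ` ?U"
        then obtain z where z: "z \<in> ball c r" "y = Cf (Cplx z)" by blast
        have "cmod (cheb n z - c) < r"
          using half[OF z(1)] z(1) norm_ge_zero[of "z - c"]
          unfolding mem_ball dist_norm norm_minus_commute[of c] by linarith
        moreover have "y = Cplx (cheb n z)" using z r(3) by (auto simp: sphere_map_cheb)
        ultimately show "y \<in> ?U" by (auto simp: dist_norm norm_minus_commute)
      qed
      show "continuous_on ?U Cf" using r(3) by (intro continuous_on_subset[OF continuous_on_Cf]) auto
    qed
    show "(\<lambda>m. (Cf ^^ m) x) \<longlonglongrightarrow> Cplx c"
    proof (rule metric_LIMSEQ_I)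
      fix e :: real assume "e > 0"
      then show "\<exists>no. \<forall>m\<ge>no. dist ((Cf ^^ m) x) (Cplx c) < e" using unif x by blast
    qed
  qed (use r in auto)
qed

lemma zero_fatou: "Cplx 0 \<in> CF"
proof -
  have "cheb_deriv n (0 ^ n :: complex) = 0" using n by (simp add: cheb_deriv_def power_0_left)
  then show ?thesis using critical_fixed_point_basin[OF zero_regular cheb_zero] by blast
qed

context
  fixes l :: complex
  assumes l: "l ^ n = 1"
begin

lemma norm_root_of_unity: "cmod l = 1"
proof -
  have "cmod l ^ n = 1" using l by (metis norm_one norm_power)
  then show ?thesis using n power_eq_1_iff[of "cmod l" n] by simp
qed

lemma root_of_unity_basin:
  "\<exists>U. open U \<and> Cplx l \<in> U \<and> U \<subseteq> CF \<and> (\<forall>x\<in>U. (\<lambda>m. (Cf ^^ m) x) \<longlonglongrightarrow> Cplx l)"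
proof (rule critical_fixed_point_basin[OF root_of_unity_regular[OF l]])
  show "cheb n l = l" using cheb_rotate[OF l, of 1] n by (simp add: cheb_one)
  show "cheb_deriv n (l ^ n) = 0" by (simp add: l cheb_deriv_def)
qed

lemma regular_ray: "x \<ge> 1 \<Longrightarrow> l * of_real x \<in> regular" for x :: real
  using norm_root_of_unity by (intro far_regular) (simp add: norm_mult)

lemma Cf_ray: "x \<ge> 1 \<Longrightarrow> Cf (Cplx (l * of_real x)) = Cplx (l * of_real (cheb n x))" for x :: real
  using regular_ray[of x] by (simp add: sphere_map_cheb cheb_rotate[OF l] cheb_of_real)

lemma Cf_iterate_ray:
  "x \<ge> 1 \<Longrightarrow> (Cf ^^ k) (Cplx (l * of_real x)) = Cplx (l * of_real ((cheb n ^^ k) x))" for x :: real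
  by (induction k) (simp_all add: Cf_ray cheb_iterate_ge_one[OF n])

lemma ray_tendsto: "x \<ge> 1 \<Longrightarrow> (\<lambda>k. (Cf ^^ k) (Cplx (l * of_real x))) \<longlonglongrightarrow> Cplx l" for x :: real
proof -
  assume x: "x \<ge> 1"
  have "(\<lambda>k. l * of_real ((cheb n ^^ k) x)) \<longlonglongrightarrow> l * of_real 1"
    by (intro tendsto_intros cheb_iterate_tendsto[OF n x])
  then have "(\<lambda>k. Cplx (l * of_real ((cheb n ^^ k) x))) \<longlonglongrightarrow> Cplx (l * of_real 1)"
    using continuous_on_tendsto_compose[OF continuous_on_Cplx[of UNIV]] by auto
  then show ?thesis using Cf_iterate_ray[OF x] by simp
qed

text \<open>Orbits on the ray eventually enter the basin of \<open>l\<close> and never meet a pole on the way.\<close>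

lemma ray_fatou: "x \<ge> 1 \<Longrightarrow> Cplx (l * of_real x) \<in> CF" for x :: real
proof -
  assume x: "x \<ge> 1"
  obtain U where U: "open U" "Cplx l \<in> U" "U \<subseteq> CF" using root_of_unity_basin by blast
  have "\<forall>\<^sub>F k in sequentially. (Cf ^^ k) (Cplx (l * of_real x)) \<in> U"
    using ray_tendsto[OF x] U(1,2) by (rule topological_tendstoD)
  then obtain k where k: "(Cf ^^ k) (Cplx (l * of_real x)) \<in> CF"
    using U(3) by (auto simp: eventually_sequentially)
  have "Cplx (l * of_real y) \<in> CF" if "y \<ge> 1" "(Cf ^^ k) (Cplx (l * of_real y)) \<in> CF" for k and y :: real
    using that
  proof (induction k arbitrary: y)
    case (Suc k)
    then have "(Cf ^^ k) (Cplx (l * of_real (cheb n y))) \<in> CF"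
      by (simp add: funpow_Suc_right Cf_ray del: funpow.simps)
    then have "Cplx (l * of_real (cheb n y)) \<in> CF"
      using Suc.IH cheb_ge_one[OF n Suc.prems(1)] by blast
    then show ?case
      using fatou_cheb_iff[OF regular_ray[OF Suc.prems(1)]] by (simp add: cheb_rotate[OF l] cheb_of_real)
  qed simp
  then show ?thesis using x k by blast
qed

text \<open>Multiplication by a root of unity commutes with the method.\<close>

lemma rotation_symmetry_cheb: "(\<lambda>z. l * z) \<in> symmetry_group (chebyshev (p_poly n))"
proof (rule rotation_mem_symmetry_group[OF norm_root_of_unity])
  fix x
  show "Cf (extend_to_sphere ((*) l) x) = extend_to_sphere ((*) l) (Cf x)"
  proof (cases x)
    case (Cplx z)
    have "l * z \<in> regular \<longleftrightarrow> z \<in> regular" by (simp add: regular_def power_mult_distrib l)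
    then show ?thesis using Cplx by (simp add: sphere_map_cheb cheb_rotate[OF l])
  qed (simp add: sphere_map_cheb)
qed

lemma rotation_symmetry_poly: "(\<lambda>z. l * z) \<in> symmetry_group (to_fract (p_poly n))"
proof (rule rotation_mem_symmetry_group[OF norm_root_of_unity])
  fix x
  have "degree (p_poly n) > 0"
  proof (rule ccontr)
    assume "\<not> degree (p_poly n) > 0"
    then obtain c where "p_poly n = [:c:]" by (metis degree_eq_zeroE not_gr_zero)
    then have "poly (p_poly n) 1 = poly (p_poly n) 2" by simp
    then show False using n power_eq_1_iff[of "2::complex" n] by (simp add: p_poly_def)
  qed
  then have inf: "sphere_map (to_fract (p_poly n)) Infty = Infty"
    using sphere_map_Fract(2)[of "p_poly n" 1] by (simp add: to_fract_def)
  show "sphere_map (to_fract (p_poly n)) (extend_to_sphere ((*) l) x)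
      = extend_to_sphere ((*) l) (sphere_map (to_fract (p_poly n)) x)"
  proof (cases x)
    case (Cplx z)
    then show ?thesis by (simp add: sphere_map_poly p_poly_def power_mult_distrib l)
  qed (simp add: inf)
qed

end

definition unit_root :: complex where
  "unit_root = cis (2 * pi / real n)"

lemma unit_root: "unit_root ^ n = 1" "unit_root \<noteq> 1"
proof -
  have "real n * (2 * pi / real n) = 2 * pi" using n by simp
  then show "unit_root ^ n = 1" by (simp only: unit_root_def Complex.DeMoivre cis_2pi)
  have "cos (2 * pi / real n) < cos 0"
    using n by (intro cos_monotone_0_pi) (auto simp: field_simps)
  then show "unit_root \<noteq> 1" unfolding unit_root_def by (metis cis.sel(1) cos_zero less_irrefl one_complex.sel(1))
qed

text \<open>A punctured neighbourhood of infinity inside the Fatou set would be connected, but it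
  contains points attracted to different roots of unity.\<close>

lemma julia_unbounded: "\<exists>z. Cplx z \<in> CJ \<and> cmod z > B"
proof (rule ccontr)
  assume none: "\<nexists>z. Cplx z \<in> CJ \<and> cmod z > B"
  define B' where "B' = max B 1"
  let ?X = "Cplx ` (- cball 0 B')"
  have "connected ?X"
    by (intro connected_continuous_image continuous_on_Cplx connected_complement_bounded_convex) auto
  moreover have "?X \<subseteq> CF" using none by (auto simp: B'_def julia_set_def not_le)
  moreover have "Cplx (1 * of_real (B' + 1)) \<in> ?X" "Cplx (unit_root * of_real (B' + 1)) \<in> ?X"
    using norm_root_of_unity[OF unit_root(1)] by (auto simp: norm_mult B'_def)
  moreover obtain U where "open U" "Cplx 1 \<in> U" "\<And>x. x \<in> U \<Longrightarrow> (\<lambda>m. (Cf ^^ m) x) \<longlonglongrightarrow> Cplx 1"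
    using root_of_unity_basin[of 1] by auto
  moreover have "(\<lambda>k. (Cf ^^ k) (Cplx (1 * of_real (B' + 1)))) \<longlonglongrightarrow> Cplx 1"
    by (rule ray_tendsto) (simp_all add: B'_def)
  ultimately have "(\<lambda>k. (Cf ^^ k) (Cplx (unit_root * of_real (B' + 1)))) \<longlonglongrightarrow> Cplx 1"
    by (rule fatou_set_connected_basin)
  moreover have "(\<lambda>k. (Cf ^^ k) (Cplx (unit_root * of_real (B' + 1)))) \<longlonglongrightarrow> Cplx unit_root"
    by (rule ray_tendsto[OF unit_root(1)]) (simp_all add: B'_def)
  ultimately have "Cplx 1 = Cplx unit_root" by (rule LIMSEQ_unique)
  then show False using unit_root(2) by simp
qed

lemma julia_rotate: "l ^ n = 1 \<Longrightarrow> Cplx (l * z) \<in> CJ \<longleftrightarrow> Cplx z \<in> CJ"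
  using symmetry_group_julia_iff[OF rotation_symmetry_cheb] by simp

lemma julia_cheb_iff: "cmod z \<ge> 1 \<Longrightarrow> Cplx (cheb n z) \<in> CJ \<longleftrightarrow> Cplx z \<in> CJ"
  using fatou_cheb_iff[OF far_regular] by (simp add: julia_set_def)

end

section \<open>The method near infinity\<close>

text \<open>This supplies the deviation \<open>E\<close> of a map \<open>u \<mapsto> u H (1 / u)\<close> from its linear part \<open>H 0 u\<close>.\<close>

lemma lipschitz_difference_quotient:
  assumes H: "H holomorphic_on ball 0 1"
  shows "\<exists>E M. M \<ge> 0 \<and> E 0 = deriv H 0 \<and> (\<forall>w. w \<noteq> 0 \<longrightarrow> E w = (H w - H 0) / w) \<and>
    (\<forall>w w'. cmod w \<le> 1 / 2 \<longrightarrow> cmod w' \<le> 1 / 2 \<longrightarrow> cmod (E w - E w') \<le> M * cmod (w - w'))"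
proof -
  define E where "E w = (if w = 0 then deriv H 0 else (H w - H 0) / (w - 0))" for w
  have hol: "E holomorphic_on ball 0 1"
    unfolding E_def[abs_def] by (rule pole_lemma_open[OF H]) simp
  have "continuous_on (cball 0 (1 / 2)) (deriv E)"
    by (intro holomorphic_on_imp_continuous_on holomorphic_on_subset[OF holomorphic_deriv[OF hol]]) auto
  then have "bounded (deriv E ` cball 0 (1 / 2))"
    by (intro compact_imp_bounded compact_continuous_image) auto
  then obtain M where M: "M > 0" "\<And>w. w \<in> cball 0 (1 / 2) \<Longrightarrow> cmod (deriv E w) \<le> M"
    by (auto simp: bounded_pos)
  have "cmod (E w - E w') \<le> M * cmod (w - w')" if "cmod w \<le> 1 / 2" "cmod w' \<le> 1 / 2" for w w'
  proof (rule field_differentiable_bound[of "cball 0 (1 / 2)" E "deriv E"])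
    fix z :: complex assume "z \<in> cball 0 (1 / 2)"
    then show "(E has_field_derivative deriv E z) (at z within cball 0 (1 / 2))"
      by (intro has_field_derivative_at_within[OF holomorphic_derivI[OF hol]]) auto
  qed (use that M in auto)
  then show ?thesis using M by (intro exI[of _ E] exI[of _ M]) (auto simp: E_def)
qed

text \<open>The factor \<^const>\<open>cheb_factor\<close> in the coordinate \<open>w = 1 / v\<close>.\<close>

definition cheb_factor_inf :: "nat \<Rightarrow> 'a::field \<Rightarrow> 'a" where
  "cheb_factor_inf n w = (of_nat n * (of_nat n + 1) * (2 * of_nat n + 1)
      - 2 * of_nat n * (of_nat n + 1) * w - of_nat n * (of_nat n - 1) * w\<^sup>2) / (2 * ((of_nat n + 1) - w) ^ 3)"

lemma cheb_factor_inf: "cheb_factor n v = cheb_factor_inf n (1 / v)" if "v \<noteq> 0"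
proof -
  have *: "v * (a * v\<^sup>2 - b * v - c) / (2 * (d * v - 1) ^ 3) = (a - b * (1 / v) - c * (1 / v)\<^sup>2) / (2 * (d - 1 / v) ^ 3)"
    for a b c d
  proof -
    have "v * (a * v\<^sup>2 - b * v - c) = v ^ 3 * (a - b * (1 / v) - c * (1 / v)\<^sup>2)"
      using that by (simp add: field_simps power2_eq_square power3_eq_cube)
    moreover have "2 * (d * v - 1) ^ 3 = v ^ 3 * (2 * (d - 1 / v) ^ 3)"
    proof -
      have "d * v - 1 = v * (d - 1 / v)" using that by (simp add: right_diff_distrib mult.commute)
      then show ?thesis by (simp add: power_mult_distrib)
    qed
    ultimately show ?thesis using that by (simp only: mult_divide_mult_cancel_left_if) simp
  qed
  show ?thesis unfolding cheb_factor_def cheb_factor_inf_def by (rule *)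
qed

lemma cheb_factor_inf_of_real: "cheb_factor_inf n (of_real x) = (of_real (cheb_factor_inf n x) :: complex)"
  by (simp add: cheb_factor_inf_def)

context chebyshev_method
begin

definition \<kappa> :: real where
  "\<kappa> = cheb_factor_inf n 0"

lemma kappa: "0 < \<kappa>" "\<kappa> < 1"
proof -
  define N where "N = real n"
  have N: "N > 1" using n by (simp add: N_def)
  have eq: "\<kappa> = N * (N + 1) * (2 * N + 1) / (2 * (N + 1) ^ 3)"
    by (simp add: \<kappa>_def cheb_factor_inf_def N_def)
  show "0 < \<kappa>" unfolding eq using N by (intro divide_pos_pos mult_pos_pos) auto
  have "2 * (N + 1) ^ 3 - N * (N + 1) * (2 * N + 1) = 3 * N\<^sup>2 + 5 * N + 2"
    by (simp add: algebra_simps power2_eq_square power3_eq_cube)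
  also have "\<dots> > 0" using N by (intro add_pos_pos) auto
  finally show "\<kappa> < 1" unfolding eq using N by (simp add: divide_less_eq)
qed

lemma has_field_derivative_cheb_factor_inf:
  "(cheb_factor_inf n has_field_derivative
     of_real (real n * (4 * real n + 1) / (2 * (real n + 1) ^ 3))) (at (0::complex))"
proof -
  define N where "N = (of_nat n :: complex)"
  have N0: "N + 1 \<noteq> 0"
  proof -
    have "complex_of_nat (Suc n) \<noteq> 0" by (simp only: of_nat_eq_0_iff)
    then show ?thesis by (simp add: N_def add.commute)
  qed
  have "((\<lambda>w. (N * (N + 1) * (2 * N + 1) - 2 * N * (N + 1) * w - N * (N - 1) * w\<^sup>2) / (2 * ((N + 1) - w) ^ 3))
      has_field_derivative
      ((- (2 * N * (N + 1))) * (2 * (N + 1) ^ 3) - (N * (N + 1) * (2 * N + 1)) * (- (6 * (N + 1)\<^sup>2)))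
        / ((2 * (N + 1) ^ 3) * (2 * (N + 1) ^ 3))) (at 0)"
    using N0 by (auto intro!: derivative_eq_intros)
  also have "((- (2 * N * (N + 1))) * (2 * (N + 1) ^ 3) - (N * (N + 1) * (2 * N + 1)) * (- (6 * (N + 1)\<^sup>2)))
      = (N * (4 * N + 1)) * (2 * (N + 1) ^ 3)"
    by (simp add: algebra_simps power2_eq_square power3_eq_cube)
  also have "(N * (4 * N + 1)) * (2 * (N + 1) ^ 3) / ((2 * (N + 1) ^ 3) * (2 * (N + 1) ^ 3))
      = N * (4 * N + 1) / (2 * (N + 1) ^ 3)"
    by (rule nonzero_mult_divide_mult_cancel_right) (use N0 in simp)
  finally show ?thesis by (simp add: cheb_factor_inf_def[abs_def] N_def)
qed

lemma holomorphic_cheb_factor_inf: "cheb_factor_inf n holomorphic_on ball 0 1"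
proof -
  have "2 * ((of_nat n + 1) - w) ^ 3 \<noteq> 0" if "w \<in> ball 0 1" for w :: complex
  proof
    assume "2 * ((of_nat n + 1) - w) ^ 3 = 0"
    then have "w = of_nat (Suc n)" by auto
    then have "cmod w = real (Suc n)" by (simp only: norm_of_nat)
    then show False using that by simp
  qed
  then show ?thesis unfolding cheb_factor_inf_def[abs_def] by (intro holomorphic_intros) auto
qed

subsection \<open>No translations\<close>

text \<open>Since \<open>n \<ge> 2\<close>, the deviation of the method from its linear part tends to \<open>0\<close> at infinity, and
  a translation invariant Julia set would come near all far multiples of the translation vector.
  These are translates of the critical fixed point \<open>0\<close>.\<close>

lemma no_translation:
  assumes b: "\<And>z. Cplx (z + b) \<in> CJ \<longleftrightarrow> Cplx z \<in> CJ"
  shows "b = 0"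
proof (rule ccontr)
  assume b0: "b \<noteq> 0"
  define H where "H w = cheb_factor_inf n (w ^ n)" for w :: complex
  have "H holomorphic_on ball 0 1"
    unfolding H_def
  proof (rule holomorphic_on_compose_gen[OF _ holomorphic_cheb_factor_inf, unfolded comp_def])
    show "(\<lambda>w. w ^ n) ` ball 0 1 \<subseteq> (ball 0 1 :: complex set)"
      using n by (auto simp: norm_power power_less_one_iff)
  qed (intro holomorphic_intros)
  then obtain E M where E: "M \<ge> 0" "E 0 = deriv H 0" "\<And>w. w \<noteq> 0 \<Longrightarrow> E w = (H w - H 0) / w"
    "\<And>w w'. cmod w \<le> 1 / 2 \<Longrightarrow> cmod w' \<le> 1 / 2 \<Longrightarrow> cmod (E w - E w') \<le> M * cmod (w - w')"
    using lipschitz_difference_quotient by blast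
  interpret asymptotically_linear \<kappa> "1 / 2" M E
    by unfold_locales (use kappa E in auto)
  have "(H has_field_derivative of_real (real n * (4 * real n + 1) / (2 * (real n + 1) ^ 3)) * (of_nat n * 0 ^ (n - 1))) (at 0)"
    unfolding H_def using has_field_derivative_cheb_factor_inf n
    by (intro DERIV_chain2[where f = "cheb_factor_inf n"]) (auto intro!: derivative_eq_intros simp: power_0_left)
  then have E0: "E 0 = 0" using n unfolding E(2) by (auto dest!: DERIV_imp_deriv simp: power_0_left)
  have H0: "H 0 = of_real \<kappa>"
    using n cheb_factor_inf_of_real[of n 0] by (simp add: H_def \<kappa>_def power_0_left)
  have Q: "Q z = cheb n z" if "cmod z \<ge> 1 / (1 / 2)" for z
  proof -
    have z: "z \<noteq> 0" using that by auto
    have "Q z = of_real \<kappa> * z + (H (1 / z) - of_real \<kappa>) / (1 / z)"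
      using E(3)[of "1 / z"] z by (simp add: Q_def H0)
    also have "\<dots> = z * H (1 / z)" using z by (simp add: algebra_simps)
    also have "\<dots> = cheb n z" using cheb_factor_inf[of "z ^ n" n] z by (simp add: H_def cheb_def power_divide)
    finally show ?thesis .
  qed
  let ?S = "{z. Cplx z \<in> CJ}"
  obtain x where x: "x \<in> ?S" using julia_unbounded by blast
  obtain e where e: "e > 0" "\<And>z. cmod z < e \<Longrightarrow> z \<notin> ?S"
  proof -
    have "open {z. Cplx z \<in> CF}" using open_Cplx_vimage[OF open_fatou_set] by (simp add: vimage_def)
    then obtain e where "e > 0" "ball 0 e \<subseteq> {z. Cplx z \<in> CF}"
      using zero_fatou open_contains_ball by blast
    then show ?thesis using that[of e] by (force simp: julia_set_def)
  qed
  have inv: "Q u \<in> ?S" if "u \<in> ?S" "cmod u \<ge> 1 / (1 / 2)" for u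
    using that Q[OF that(2)] julia_cheb_iff[of u] by simp
  obtain k y where y: "y \<in> ?S" "cmod (y - of_nat k * b) < e"
    using translation_invariant_meets_ray[of ?S b x e, OF inv _ b0 x E0 e(1)] b by blast
  have "Cplx (z + of_nat k * b) \<in> CJ \<longleftrightarrow> Cplx z \<in> CJ" for z
  proof (induction k)
    case (Suc k)
    then show ?case using b[of "z + of_nat k * b"] by (simp add: algebra_simps)
  qed simp
  from this[of "y - of_nat k * b"] have "y - of_nat k * b \<in> ?S" using y(1) by simp
  then show False using e(2) y(2) by blast
qed

subsection \<open>Rotations\<close>

text \<open>The quotient by the group of \<open>n\<close>-th roots of unity is taken by \<open>u = z ^ n\<close>.  There the method becomes
  \<open>u \<mapsto> u (cheb_factor u) ^ n\<close>, whose deviation from the linear part tends to a nonzero real constant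
  at infinity, so that \<open>rotation_trivial\<close> applies to the image of the Julia set.\<close>

lemma rotation_is_root_of_unity:
  assumes a: "cmod a = 1" "\<And>z. Cplx (a * z) \<in> CJ \<longleftrightarrow> Cplx z \<in> CJ"
  shows "a ^ n = 1"
proof -
  define S where "S = {u. \<exists>z. z ^ n = u \<and> Cplx z \<in> CJ}"
  have n0: "n > 0" using n by simp
  have root: "\<exists>z. z ^ n = u" for u :: complex
  proof (cases "u = 0")
    case False
    have "exp (Ln u / of_nat n) ^ n = u"
      using False n0 by (simp flip: exp_of_nat_mult)
    then show ?thesis by blast
  qed (use n0 in \<open>auto intro!: exI[of _ 0]\<close>)
  have S: "z ^ n \<in> S \<longleftrightarrow> Cplx z \<in> CJ" for z
  proof
    assume "z ^ n \<in> S"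
    then obtain y where y: "y ^ n = z ^ n" "Cplx y \<in> CJ" by (auto simp: S_def)
    show "Cplx z \<in> CJ"
    proof (cases "y = 0")
      case True
      then have "z = 0" using y(1) n0 by (simp add: power_0_left)
      then show ?thesis using y True by simp
    next
      case False
      then have "z ^ n \<noteq> 0" using y(1) by (metis power_not_zero)
      then have "(z / y) ^ n = 1" using y(1) by (simp add: power_divide)
      then show ?thesis using julia_rotate[of "z / y" y] y(2) False by simp
    qed
  qed (auto simp: S_def)
  have clS: "closed S"
  proof -
    have "- S = (\<lambda>z. z ^ n) ` {z. Cplx z \<in> CF}"
    proof (intro equalityI subsetI)
      fix u assume u: "u \<in> - S"
      obtain z where z: "z ^ n = u" using root by blast
      then have "Cplx z \<in> CF" using u S[of z] by (simp add: julia_set_def)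
      then show "u \<in> (\<lambda>z. z ^ n) ` {z. Cplx z \<in> CF}" using z by blast
    qed (auto simp: S julia_set_def)
    moreover have "open ((\<lambda>z::complex. z ^ n) ` {z. Cplx z \<in> CF})"
    proof (rule open_mapping_thm[of _ UNIV])
      show "open {z. Cplx z \<in> CF}" using open_Cplx_vimage[OF open_fatou_set] by (simp add: vimage_def)
      show "\<not> (\<lambda>z::complex. z ^ n) constant_on UNIV"
      proof
        assume "(\<lambda>z::complex. z ^ n) constant_on UNIV"
        then have "(0::complex) ^ n = 1 ^ n" unfolding constant_on_def by (metis UNIV_I)
        then show False using n0 by (simp add: power_0_left)
      qed
    qed (auto intro!: holomorphic_intros)
    ultimately show ?thesis by (simp add: closed_def)
  qed
  define H where "H w = cheb_factor_inf n w ^ n" for w :: complex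
  have "H holomorphic_on ball 0 1"
    unfolding H_def by (intro holomorphic_intros holomorphic_cheb_factor_inf)
  then obtain E M where E: "M \<ge> 0" "E 0 = deriv H 0" "\<And>w. w \<noteq> 0 \<Longrightarrow> E w = (H w - H 0) / w"
    "\<And>w w'. cmod w \<le> 1 / 2 \<Longrightarrow> cmod w' \<le> 1 / 2 \<Longrightarrow> cmod (E w - E w') \<le> M * cmod (w - w')"
    using lipschitz_difference_quotient by blast
  have K: "0 < \<kappa> ^ n" "\<kappa> ^ n < 1"
    using kappa n0 by (simp_all add: power_less_one_iff)
  interpret asymptotically_linear "\<kappa> ^ n" "1 / 2" M E
    by unfold_locales (use K E in auto)
  have F0: "cheb_factor_inf n 0 = complex_of_real \<kappa>"
    using cheb_factor_inf_of_real[of n 0] by (simp add: \<kappa>_def)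
  define c where "c = real n * (4 * real n + 1) / (2 * (real n + 1) ^ 3)"
  define e0 where "e0 = real n * \<kappa> ^ (n - 1) * c"
  have "c > 0" unfolding c_def using n by (intro divide_pos_pos) auto
  then have e0: "e0 \<noteq> 0" using kappa n0 by (simp add: e0_def)
  have "(H has_field_derivative (of_nat n * cheb_factor_inf n 0 ^ (n - 1) * of_real c)) (at 0)"
    unfolding H_def c_def
    using DERIV_power[OF has_field_derivative_cheb_factor_inf, of n] by (simp add: mult_ac)
  then have E0: "E 0 = of_real e0"
    unfolding E(2) by (auto dest!: DERIV_imp_deriv simp: F0 e0_def)
  have H0: "H 0 = of_real (\<kappa> ^ n)" by (simp add: H_def F0)
  have Q: "Q u = u * H (1 / u)" if "u \<noteq> 0" for u
    using E(3)[of "1 / u"] that by (simp add: Q_def H0 algebra_simps)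
  have Qpow: "Q (z ^ n) = cheb n z ^ n" if "z \<noteq> 0" for z
    using Q[of "z ^ n"] that cheb_factor_inf[of "z ^ n" n] by (simp add: H_def cheb_def power_mult_distrib)
  have "a ^ n = 1"
  proof (rule rotation_trivial[of "a ^ n" S e0 1, OF _ _ _ clS _ E0 e0])
    show "cmod (a ^ n) = 1" using a by (simp add: norm_power)
    fix u :: complex
    obtain z where z: "z ^ n = u" using root by blast
    show "a ^ n * u \<in> S \<longleftrightarrow> u \<in> S"
      using S[of "a * z"] S[of z] a(2)[of z] by (simp add: power_mult_distrib z)
  next
    fix u :: complex assume u: "1 / (1 / 2) \<le> cmod u"
    obtain z where z: "z ^ n = u" using root by blast
    have z1: "cmod z \<ge> 1"
    proof (rule ccontr)
      assume "\<not> cmod z \<ge> 1"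
      then have "cmod z ^ n < 1" using n0 by (simp add: power_less_one_iff)
      then show False using u z by (simp flip: norm_power)
    qed
    then have "z \<noteq> 0" by auto
    then have "Q u = cheb n z ^ n" using Qpow[of z] z by simp
    then show "Q u \<in> S \<longleftrightarrow> u \<in> S" using S[of "cheb n z"] S[of z] z julia_cheb_iff[OF z1] by simp
  next
    fix N :: real
    obtain z where z: "Cplx z \<in> CJ" "cmod z > max N 1" using julia_unbounded by blast
    have "cmod z \<le> cmod (z ^ n)" using z(2) n0 by (simp add: norm_power self_le_power)
    then show "\<exists>u\<in>S. cmod u > N" using z S[of z] by (intro bexI[of _ "z ^ n"]) auto
  next
    fix x :: real assume x: "x \<ge> 1"
    have "Q (of_real x) = of_real (x * cheb_factor_inf n (1 / x) ^ n)"
      using x cheb_factor_inf_of_real[of n "1 / x"] by (simp add: Q H_def)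
    then show "Im (Q (of_real x)) = 0" by (simp only: Im_complex_of_real)
    have "root n x \<ge> 1" using x n0 by simp
    then have "Cplx (of_real (root n x)) \<in> CF" using ray_fatou[of 1 "root n x"] by simp
    then have "of_real (root n x) ^ n \<notin> S" using S by (simp add: julia_set_def)
    also have "of_real (root n x) ^ n = complex_of_real x"
      using x n0 by (simp flip: of_real_power)
    finally show "of_real x \<notin> S" .
  qed
  then show ?thesis .
qed

lemma symmetry_group_cheb:
  "symmetry_group (chebyshev (p_poly n)) = {s. \<exists>l. l ^ n = 1 \<and> s = (\<lambda>z. l * z)}"
proof (intro equalityI subsetI)
  fix s assume s: "s \<in> symmetry_group (chebyshev (p_poly n))"
  then obtain a b where ab: "cmod a = 1" "s = (\<lambda>z. a * z + b)" unfolding symmetry_group_def by blast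
  have J: "Cplx (a * z + b) \<in> CJ \<longleftrightarrow> Cplx z \<in> CJ" for z
    using symmetry_group_julia_iff[OF s] ab(2) by simp
  have a0: "a \<noteq> 0" using ab(1) by auto
  let ?l = unit_root
  have l0: "?l \<noteq> 0" using norm_root_of_unity[OF unit_root(1)] by auto
  \<comment> \<open>the commutator of \<open>s\<close> with a rotation that generates the roots of unity is a translation\<close>
  have "(1 - ?l) * b = 0"
  proof (rule no_translation)
    fix z
    define w where "w = (z / ?l - b) / a"
    have "a * (?l * w) + b = z + (1 - ?l) * b"
      using a0 l0 by (simp add: w_def algebra_simps)
    moreover have "?l * (a * w + b) = z" using a0 l0 by (simp add: w_def)
    ultimately show "Cplx (z + (1 - ?l) * b) \<in> CJ \<longleftrightarrow> Cplx z \<in> CJ"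
      using J[of "?l * w"] J[of w] julia_rotate[OF unit_root(1)] by metis
  qed
  then have b: "b = 0" using unit_root(2) by simp
  then have "a ^ n = 1" using J by (intro rotation_is_root_of_unity ab(1)) simp
  then show "s \<in> {s. \<exists>l. l ^ n = 1 \<and> s = (\<lambda>z. l * z)}" using ab(2) b by auto
qed (use rotation_symmetry_cheb in auto)

lemma symmetry_group_p_poly:
  "symmetry_group (to_fract (p_poly n)) = {s. \<exists>l. l ^ n = 1 \<and> s = (\<lambda>z. l * z)}"
proof (intro equalityI subsetI)
  fix s assume s: "s \<in> symmetry_group (to_fract (p_poly n))"
  then obtain a b where ab: "cmod a = 1" "s = (\<lambda>z. a * z + b)" unfolding symmetry_group_def by blast
  have pp: "p_poly n = monom 1 (n + 1) - monom 1 1"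
    by (simp add: p_poly_def monom_altdef algebra_simps)
  have coeff: "coeff (p_poly n) k = (if k = n + 1 then 1 else 0) - (if k = 1 then 1 else 0)" for k
    unfolding pp coeff_diff coeff_monom by auto
  have deg_p: "degree (p_poly n) = n + 1"
  proof (rule antisym)
    show "degree (p_poly n) \<le> n + 1" by (rule degree_le) (simp add: coeff)
    show "n + 1 \<le> degree (p_poly n)" by (rule le_degree) (use n in \<open>simp add: coeff\<close>)
  qed
  interpret centred_polynomial "p_poly n" 2
  proof
    show "lead_coeff (p_poly n) = 1" "degree (p_poly n) \<ge> 2" "coeff (p_poly n) (degree (p_poly n) - 1) = 0"
      unfolding deg_p coeff using n by simp_all
    show "poly (p_poly n) 0 = 0" by (simp add: p_poly_def)
    fix z :: complex assume z: "cmod z > 2"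
    have "cmod z ^ 1 \<le> cmod z ^ n" using z n by (intro power_increasing) auto
    moreover have "2 * 2 \<le> cmod z ^ 2" unfolding power2_eq_square using z by (intro mult_mono) auto
    moreover have "cmod z ^ 2 \<le> cmod z ^ n" using z n by (intro power_increasing) auto
    ultimately have "2 \<le> cmod (z ^ n) - cmod 1" by (simp add: norm_power)
    also have "\<dots> \<le> cmod (z ^ n - 1)" by (rule norm_triangle_ineq2)
    finally have "cmod z * 2 \<le> cmod z * cmod (z ^ n - 1)" by (intro mult_left_mono) auto
    then show "2 * cmod z \<le> cmod (poly (p_poly n) z)" by (simp add: p_poly_def norm_mult mult.commute)
  qed simp
  have b: "b = 0" and eq: "poly (p_poly n) (a * z) = a ^ (n + 1) * poly (p_poly n) z" for z
    using symmetry_equivariant[of a b] s ab deg_p by auto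
  have "a * (a ^ n * 2 ^ n - 1) * 2 = a * a ^ n * (2 ^ n - 1) * 2"
    using eq[of 2] by (simp add: p_poly_def power_mult_distrib algebra_simps)
  then have "a * (a ^ n - 1) = 0" by (simp add: algebra_simps)
  then have "a ^ n = 1" using ab(1) by auto
  then show "s \<in> {s. \<exists>l. l ^ n = 1 \<and> s = (\<lambda>z. l * z)}" using ab(2) b by auto
qed (use rotation_symmetry_poly in auto)

end

theorem theorem5:
  fixes n :: nat
  assumes "n > 1"
  shows "symmetry_group (to_fract (p_poly n)) = symmetry_group (chebyshev (p_poly n))"
proof -
  interpret chebyshev_method n by unfold_locales (rule assms)
  show ?thesis unfolding symmetry_group_cheb symmetry_group_p_poly ..
qed

end
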